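(* Let $C\subseteq\mathbb{R}^n$ be the positive orthant, let $V$ be a positive integer, and let $B_1,\ldots,B_n\subseteq C$ be lattice polyhedra with each $C\setminus B_i$ bounded such that the tuple $(B_1,\ldots,B_n)$ is minimal with mixed volume $V$. Then $C_{V,\ldots,V}\subseteq B_i$ for every $i\in\{1,\ldots,n\}$.
   Context: A lattice polyhedron is an intersection of finitely many closed half-spaces all of whose vertices lie in $\mathbb{Z}^n$. Lattice volume is $n!$ times Euclidean volume. For polyhedra $B\subseteq C$ with $C\setminus B$ bounded, put $\mathrm{V}(C,B)=$ lattice volume of $C\setminus B$, and define the relative mixed volume $\mathrm{Vol}_C((C,B_1),\ldots,(C,B_n))=\sum_{I\subseteq\{1,\ldots,n\}}(-1)^{n-|I|}\,\mathrm{V}\big(C,\sum_{i\in I}B_i\big)$ (Minkowski sums; empty sum $=C$); it is the unique symmetric, Minkowski-multilinear function with $\mathrm{Vol}_C((C,B),\ldots,(C,B))=\mathrm{V}(C,B)$. For $a_1,\ldots,a_n>0$, $C_{a_1,\ldots,a_n}=\{x\in C:\sum_i x_i/a_i\ge 1\}$. A tuple $(B_1,\ldots,B_n)$ is minimal with mixed volume $V$ if $\mathrm{Vol}_C((C,B_1),\ldots,(C,B_n))=V$ and, for every $i$ and every point $\delta\in C\setminus B_i$, replacing $B_i$ by $\mathrm{conv}(B_i\cup\{\delta\})$ gives mixed volume strictly less than $V$.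
   Formalization: The relative mixed volume is the alternating sum of lattice volumes divided by n!, so that Vol_C((C,B),…,(C,B)) = V(C,B) holds; without the factor 1/n! the displayed sum gives n!·V(C,B) on the diagonal, contradicting that property. *)

theory Defs
  imports "HOL-Analysis.Analysis"
begin

definition positive_orthant :: "(real ^ 'n) set" where
  "positive_orthant = {x. \<forall>i. 0 \<le> x $ i}"

definition lattice_polyhedron :: "(real ^ 'n) set \<Rightarrow> bool" where
  "lattice_polyhedron P \<longleftrightarrow>
     polyhedron P \<and> (\<forall>v. v extreme_point_of P \<longrightarrow> (\<forall>i. v $ i \<in> \<int>))"

text \<open>Only meaningful when \<^term>\<open>B \<subseteq> C\<close> and \<^term>\<open>C - B\<close> is bounded.\<close>

definition rel_volume :: "(real ^ 'n) set \<Rightarrow> (real ^ 'n) set \<Rightarrow> real" where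
  "rel_volume C B = fact CARD('n) * measure lebesgue (C - B)"

text \<open>The sum in the second branch is the Minkowski sum of \<^theory>\<open>HOL-Library.Set_Algebras\<close>.
  Its value on the empty index set is \<^term>\<open>{0}\<close>, whereas relative to \<^term>\<open>C\<close> the empty
  sum is \<^term>\<open>C\<close>.\<close>

definition rel_minkowski_sum ::
    "(real ^ 'n) set \<Rightarrow> ('i \<Rightarrow> (real ^ 'n) set) \<Rightarrow> 'i set \<Rightarrow> (real ^ 'n) set" where
  "rel_minkowski_sum C B I = (if I = {} then C else (\<Sum>i\<in>I. B i))"

text \<open>An \<open>n\<close>-tuple of subsets of \<open>\<real>\<^sup>n\<close> is indexed by the same type as the coordinates. The factor
  \<open>1/n!\<close> gives the polarization of the lattice volume for which
  \<open>Vol\<^sub>C((C,B),\<dots>,(C,B)) = V(C,B)\<close>; without it the alternating sum of lattice volumes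
  would be \<open>n!\<close> times larger. See \<open>rel_mixed_volume_diagonal\<close> below.\<close>

definition rel_mixed_volume :: "(real ^ 'n) set \<Rightarrow> ('n \<Rightarrow> (real ^ 'n) set) \<Rightarrow> real" where
  "rel_mixed_volume C B =
     (\<Sum>I\<in>(UNIV :: 'n set set). (-1) ^ (CARD('n) - card I) *
        rel_volume C (rel_minkowski_sum C B I)) / fact CARD('n)"

definition cone_above :: "(real ^ 'n) set \<Rightarrow> ('n \<Rightarrow> real) \<Rightarrow> (real ^ 'n) set" where
  "cone_above C a = {x \<in> C. (\<Sum>i\<in>UNIV. x $ i / a i) \<ge> 1}"

text \<open>The added point \<open>\<delta>\<close> ranges over all real points of \<^term>\<open>C - B i\<close>, not only over lattice
  points.\<close>

definition minimal_with_mixed_volume ::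
    "(real ^ 'n) set \<Rightarrow> ('n \<Rightarrow> (real ^ 'n) set) \<Rightarrow> real \<Rightarrow> bool" where
  "minimal_with_mixed_volume C B v \<longleftrightarrow>
     rel_mixed_volume C B = v \<and>
     (\<forall>i. \<forall>\<delta> \<in> C - B i.
        rel_mixed_volume C (B(i := convex hull (insert \<delta> (B i)))) < v)"


subsection \<open>Normalization of the mixed volume\<close>

lemma alternating_sum_choose_power:
  assumes "m \<le> n"
  shows "(\<Sum>k\<le>n. (-1) ^ (n - k) * real (n choose k) * real k ^ m) =
         (if m = n then fact n else 0)"
  using assms
proof (induction n arbitrary: m)
  case 0
  then show ?case by simp
next
  case (Suc n)
  show ?case
  proof (cases m)
    case 0
    have "(\<Sum>k\<le>Suc n. (-1) ^ (Suc n - k) * real (Suc n choose k)) =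
          (\<Sum>k\<le>Suc n. (-1) ^ Suc n * ((-1) ^ k * real (Suc n choose k)))"
      by (intro sum.cong refl) (auto simp: minus_one_power_iff)
    also have "\<dots> = 0"
      by (subst sum_distrib_left [symmetric], subst choose_alternating_sum) auto
    finally show ?thesis using 0 by simp
  next
    case m: (Suc p)
    let ?S = "\<lambda>i. \<Sum>k\<le>n. (-1) ^ (n - k) * real (n choose k) * real k ^ i"
    have "(\<Sum>k\<le>Suc n. (-1) ^ (Suc n - k) * real (Suc n choose k) * real k ^ Suc p) =
          (\<Sum>k\<le>n. (-1) ^ (n - k) * (real (Suc k) * real (Suc n choose Suc k)) * real (Suc k) ^ p)"
      by (subst sum.atMost_Suc_shift) (simp add: mult_ac del: binomial_Suc_Suc of_nat_Suc)
    also have "\<dots> = (\<Sum>k\<le>n. (-1) ^ (n - k) * (real (Suc n) * real (n choose k)) *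
                      (\<Sum>i\<le>p. real (p choose i) * real k ^ i))"
    proof (intro sum.cong refl)
      fix k
      have "real (Suc k) ^ p = (\<Sum>i\<le>p. real (p choose i) * real k ^ i)"
        using binomial_ring[of "real k" 1 p] by (simp add: add.commute)
      moreover have "real (Suc k) * real (Suc n choose Suc k) = real (Suc n) * real (n choose k)"
        by (metis Suc_times_binomial of_nat_mult)
      ultimately show "(-1) ^ (n - k) * (real (Suc k) * real (Suc n choose Suc k)) * real (Suc k) ^ p
          = (-1) ^ (n - k) * (real (Suc n) * real (n choose k)) *
            (\<Sum>i\<le>p. real (p choose i) * real k ^ i)"
        by presburger
    qed
    also have "\<dots> = (\<Sum>k\<le>n. \<Sum>i\<le>p. real (Suc n) * real (p choose i) *
                      ((-1) ^ (n - k) * real (n choose k) * real k ^ i))"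
      by (simp add: sum_distrib_left mult_ac)
    also have "\<dots> = (\<Sum>i\<le>p. real (Suc n) * real (p choose i) * ?S i)"
      by (subst sum.swap) (simp add: sum_distrib_left)
    also have "\<dots> = (\<Sum>i\<le>p. if i = n then real (Suc n) * real (p choose i) * fact n else 0)"
      using Suc m by (intro sum.cong) auto
    also have "\<dots> = (if m = Suc n then fact (Suc n) else 0)"
      using Suc.prems m by (auto simp: sum.delta)
    finally show ?thesis using m by simp
  qed
qed

lemma sum_constant_convex:
  fixes B :: "'a::real_vector set"
  assumes "convex B" "finite I" "I \<noteq> {}"
  shows "(\<Sum>i\<in>I. B) = (*\<^sub>R) (real (card I)) ` B"
  using assms(2,3)
proof (induction I rule: finite_ne_induct)
  case (singleton x)
  then show ?case by simp
next
  case (insert x F)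
  have "B + (*\<^sub>R) (real (card F)) ` B = (*\<^sub>R) (1 + real (card F)) ` B"
  proof (intro equalityI subsetI)
    fix y assume "y \<in> B + (*\<^sub>R) (real (card F)) ` B"
    then obtain u v where uv: "u \<in> B" "v \<in> B" "y = u + real (card F) *\<^sub>R v"
      by (auto simp: set_plus_def)
    let ?c = "1 + real (card F)"
    have "(1 / ?c) *\<^sub>R u + (real (card F) / ?c) *\<^sub>R v \<in> B"
      by (rule convexD[OF assms(1) uv(1,2)]) (auto simp: field_simps)
    moreover have "y = ?c *\<^sub>R ((1 / ?c) *\<^sub>R u + (real (card F) / ?c) *\<^sub>R v)"
      using uv(3) by (simp add: scaleR_add_right add_nonneg_eq_0_iff)
    ultimately show "y \<in> (*\<^sub>R) ?c ` B" by blast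
  next
    fix y assume "y \<in> (*\<^sub>R) (1 + real (card F)) ` B"
    then show "y \<in> B + (*\<^sub>R) (real (card F)) ` B"
      by (auto simp: scaleR_add_left intro!: set_plus_intro)
  qed
  then show ?case using insert by simp
qed

lemma closed_positive_orthant: "closed (positive_orthant :: (real ^ 'n) set)"
  unfolding positive_orthant_def by (intro closed_Collect_all closed_Collect_le continuous_intros)

lemma scaleR_positive_orthant:
  assumes "c > 0"
  shows "(*\<^sub>R) c ` (positive_orthant :: (real ^ 'n) set) = positive_orthant"
proof (intro equalityI subsetI)
  fix x :: "real ^ 'n" assume "x \<in> positive_orthant"
  then have "(1 / c) *\<^sub>R x \<in> positive_orthant" "x = c *\<^sub>R ((1 / c) *\<^sub>R x)"
    using assms by (auto simp: positive_orthant_def)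
  then show "x \<in> (*\<^sub>R) c ` positive_orthant" by blast
qed (use assms in \<open>auto simp: positive_orthant_def\<close>)

lemma rel_volume_scaleR:
  fixes B :: "(real ^ 'n) set"
  assumes "closed B" "bounded (positive_orthant - B)" "c > 0"
  shows "rel_volume positive_orthant ((*\<^sub>R) c ` B) =
         c ^ CARD('n) * rel_volume positive_orthant B"
proof -
  let ?C = "positive_orthant :: (real ^ 'n) set"
  have inj: "inj ((*\<^sub>R) c :: real ^ 'n \<Rightarrow> _)"
    using assms(3) by (auto intro: injI)
  have lm: "?C - B \<in> lmeasurable"
    using assms closed_positive_orthant
    by (intro bounded_set_imp_lmeasurable sets_completionI_sets)
       (auto intro: sets.Diff[OF borel_closed borel_closed])
  have "?C - (*\<^sub>R) c ` B = (*\<^sub>R) c ` (?C - B)"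
    by (simp add: image_set_diff[OF inj] scaleR_positive_orthant assms(3))
  also have "\<dots> = (\<lambda>x. \<chi> k. c * x $ k) ` (?C - B)"
    by (intro image_cong refl) (simp add: vec_eq_iff)
  finally show ?thesis
    using measure_stretch[OF lm, of "\<lambda>_. c"] assms(3) by (simp add: rel_volume_def)
qed

lemma rel_mixed_volume_diagonal:
  fixes B :: "(real ^ 'n) set"
  assumes "closed B" "convex B" "bounded (positive_orthant - B)"
  shows "rel_mixed_volume positive_orthant (\<lambda>_. B) = rel_volume positive_orthant B"
proof -
  let ?C = "positive_orthant :: (real ^ 'n) set" and ?n = "CARD('n)"
  let ?V = "rel_volume ?C B"
  have vol: "rel_volume ?C (rel_minkowski_sum ?C (\<lambda>_. B) I) = real (card I) ^ ?n * ?V"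
    for I :: "'n set"
  proof (cases "I = {}")
    case True
    then show ?thesis by (simp add: rel_minkowski_sum_def rel_volume_def)
  next
    case False
    then show ?thesis
      using assms by (simp add: rel_minkowski_sum_def sum_constant_convex rel_volume_scaleR
                                card_gt_0_iff)
  qed
  have "(\<Sum>I\<in>(UNIV :: 'n set set). (-1) ^ (?n - card I) *
          rel_volume ?C (rel_minkowski_sum ?C (\<lambda>_. B) I)) =
        (\<Sum>I\<in>(UNIV :: 'n set set). (-1) ^ (?n - card I) * (real (card I) ^ ?n * ?V))"
    by (simp add: vol)
  also have "\<dots> = (\<Sum>k\<le>?n. \<Sum>I | I \<in> UNIV \<and> card I = k.
                    (-1) ^ (?n - card (I :: 'n set)) * (real (card I) ^ ?n * ?V))"
    by (rule sum.group[symmetric]) (auto simp: card_mono)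
  also have "\<dots> = (\<Sum>k\<le>?n. (-1) ^ (?n - k) * real (?n choose k) * real k ^ ?n) * ?V"
    unfolding sum_distrib_right
  proof (intro sum.cong refl)
    fix k
    have "card {I :: 'n set. card I = k} = ?n choose k"
      using n_subsets[of "UNIV :: 'n set" k] by simp
    then show "(\<Sum>I | I \<in> UNIV \<and> card I = k.
                 (-1) ^ (?n - card (I :: 'n set)) * (real (card I) ^ ?n * ?V)) =
               (-1) ^ (?n - k) * real (?n choose k) * real k ^ ?n * ?V"
      by simp
  qed
  also have "\<dots> = fact ?n * ?V"
    by (simp add: alternating_sum_choose_power)
  finally show ?thesis
    by (simp add: rel_mixed_volume_def)
qed

end

theory Submission
  imports Defs
begin

text \<open>If some \<open>V e\<^sub>j\<close> is missing from \<open>B\<^sub>m\<close>, then \<open>B\<^sub>m\<close> has a vertex \<open>p e\<^sub>j\<close> with an integer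
  \<open>p > V\<close>. Insert \<open>\<delta> = (p - 1) e\<^sub>j\<close> into \<open>B\<^sub>m\<close>. By minimality and integrality of mixed volumes, the
  relative mixed volume drops by at least 1. On the other hand the enlarged polyhedron is contained
  in \<open>(1 - 1/p) B\<^sub>m\<close>, so by monotonicity and linearity the mixed volume drops by at most
  \<open>V/p < 1\<close>, a contradiction.

  Cutting the \<open>B\<^sub>i\<close> by a large simplex reduces this to mixed volumes of polytopes. For a polytope
  \<open>P\<close> with positively weighted vertices \<open>a\<^sub>k\<close>, the gradient of \<open>ln (\<Sum>\<^sub>k c\<^sub>k exp (a\<^sub>k \<bullet> u))\<close> is a
  bijection from \<open>\<real>\<^sup>n\<close> onto the interior of \<open>P\<close>, and similarly for positive combinations. Hence the
  mixed volume is the integral of the mixed discriminant of the Hessians, which are covariance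
  matrices. This gives linearity at once. Since the integral does not depend on the weights,
  letting weights tend to 0 gives monotonicity by Fatou's lemma, and letting them degenerate as
  \<open>exp (s \<omega>\<^sub>k)\<close> with \<open>s \<rightarrow> \<infinity>\<close> and generic \<open>\<omega>\<close> concentrates the integral in finitely many points,
  each contributing the absolute value of an integer determinant.\<close>

subsection \<open>Mixed discriminants\<close>

text \<open>The volume of a Minkowski sum is not visibly polynomial in its summands. Under the
  gradient parametrization the Jacobian of a sum is the determinant of a sum of matrices, so
  polarization can be done pointwise under the integral, where it is plain linear algebra. The
  Hessians are written as nonnegative combinations of rank-one matrices built from differences of
  points. This turns the mixed discriminant into a sum of squared determinants with explicit
  coefficients, which gives nonnegativity (no absolute value in the change of variables, and an
  integrand suited to Fatou), continuity in the weights, and the individual terms of the tropical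
  limit. Cutting reverses the order: enlarging a \<open>B i\<close> lowers the relative mixed volume
  and raises the mixed volume of the cut polytopes. The number \<open>V\<close> reappears as the gap
  between the mixed volume of the cut orthant and that of the cut \<open>B i\<close>. Since the cut
  orthant contains 0, shrinking towards 0 by \<open>1 - 1/p\<close> becomes a convex combination
  with the cut orthant, to which multilinearity applies.\<close>

definition mixed_disc :: "('n::finite \<Rightarrow> real^'n^'n) \<Rightarrow> real" where
  "mixed_disc H = (\<Sum>p | p permutes UNIV. det (\<chi> r. H (p r) $ r))"

text \<open>Passing to the complement of \<open>I\<close> turns the sum into the expansion of the
  product of \<open>1 + (-1)\<close> over the indices outside \<open>R\<close>. It serves to discard
  the row selections that miss an index.\<close>

lemma sum_alternating_supersets:
  fixes R :: "'n::finite set"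
  shows "(\<Sum>I\<in>UNIV. if R \<subseteq> I then (-1) ^ (CARD('n) - card I) else 0) = (if R = UNIV then 1 else (0::real))"
proof -
  have "(\<Sum>I\<in>UNIV. if R \<subseteq> I then (-1) ^ (CARD('n) - card I) else (0::real)) =
     (\<Sum>I | R \<subseteq> I. (-1) ^ (CARD('n) - card I))"
    by (simp add: sum.If_cases)
  also have "\<dots> = (\<Sum>X\<in>Pow (- R). (-1) ^ card X)"
    by (rule sum.reindex_bij_witness[where i=uminus and j=uminus])
      (auto simp: Compl_eq_Diff_UNIV card_Diff_subset)
  also have "\<dots> = (\<Prod>i\<in>-R. 1 + (-1))"
    by (subst add.commute, subst prod_add) auto
  also have "\<dots> = (if R = UNIV then 1 else 0)"
    by auto
  finally show ?thesis .
qed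

text \<open>The determinant of a sum expands by rows over maps \<open>f\<close> that take row
  \<open>r\<close> from \<open>H (f r)\<close>. The alternating sum keeps only the surjective
  \<open>f\<close>, which on a finite type are the permutations. The signs agree with those of
  \<open>rel_mixed_volume\<close>, so volumes and determinants polarize alike.\<close>

lemma mixed_disc_polarization:
  fixes H :: "'n::finite \<Rightarrow> real^'n^'n"
  shows "(\<Sum>I\<in>UNIV. (-1) ^ (CARD('n) - card I) * det (\<Sum>i\<in>I. H i)) = mixed_disc H"
proof -
  let ?d = "\<lambda>f. det (\<chi> r. H (f r) $ r)"
  have "det (\<Sum>i\<in>I. H i) = (\<Sum>f\<in>UNIV. if range f \<subseteq> I then ?d f else 0)" for I :: "'n set"
  proof -
    have "(\<Sum>i\<in>I. H i) = (\<chi> r. \<Sum>i\<in>I. H i $ r)"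
      by (simp add: vec_eq_iff)
    then have "det (\<Sum>i\<in>I. H i) = (\<Sum>f | \<forall>r. f r \<in> I. ?d f)"
      using det_linear_rows_sum[of I "\<lambda>r i. H i $ r"] by simp
    also have "{f. \<forall>r. f r \<in> I} = {f. range f \<subseteq> I}"
      by auto
    finally show ?thesis
      by (simp add: sum.If_cases)
  qed
  then have "(\<Sum>I\<in>UNIV. (-1) ^ (CARD('n) - card I) * det (\<Sum>i\<in>I. H i))
     = (\<Sum>I\<in>UNIV. \<Sum>f\<in>UNIV. (if range f \<subseteq> I then (-1) ^ (CARD('n) - card I) else 0) * ?d f)"
    by (auto simp: sum_distrib_left intro!: sum.cong)
  also have "\<dots> = (\<Sum>f\<in>UNIV. (if range f = UNIV then 1 else 0) * ?d f)"
    by (subst sum.swap) (simp flip: sum_distrib_right sum_alternating_supersets)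
  also have "\<dots> = (\<Sum>f | range f = UNIV. ?d f)"
    by (auto simp: sum.If_cases if_distrib[of "\<lambda>x. x * _"] cong: if_cong)
  also have "{f :: 'n \<Rightarrow> 'n. range f = UNIV} = {p. p permutes UNIV}"
    by (auto simp: permutes_surj intro!: bij_imp_permutes bij_betw_imageI finite_UNIV_surj_inj)
  finally show ?thesis
    by (simp add: mixed_disc_def)
qed

lemma det_rows_sum:
  fixes a :: "'n::finite \<Rightarrow> 'e \<Rightarrow> real^'n"
  assumes "finite S"
  shows "det (\<chi> i. sum (a i) S) = (\<Sum>f | \<forall>i. f i \<in> S. det (\<chi> i. a i (f i)))"
proof -
  have "(\<Prod>i\<in>UNIV. \<Sum>e\<in>S. a i e $ p i) = (\<Sum>f | \<forall>i. f i \<in> S. \<Prod>i\<in>UNIV. a i (f i) $ p i)" for p :: "'n \<Rightarrow> 'n"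
  proof -
    have "(\<Pi>\<^sub>E i\<in>UNIV. S) = {f :: 'n \<Rightarrow> 'e. \<forall>i. f i \<in> S}"
      by (auto simp: PiE_def)
    then show ?thesis
      using prod_sum_PiE[of UNIV "\<lambda>_. S" "\<lambda>i e. a i e $ p i"] assms by simp
  qed
  then show ?thesis
    by (simp add: det_def sum_distrib_left, subst sum.swap, simp)
qed

text \<open>A Cauchy-Binet argument: choose one rank-one term \<open>g i\<close> from each matrix.
  Each permutation contributes its sign, a product of entries and one factor
  \<open>det (\<chi> i. x (g i))\<close>; summed over the permutations, the signed products give
  that determinant a second time, hence the square.\<close>

lemma mixed_disc_rank_one:
  fixes x :: "'e \<Rightarrow> real^'n::finite"
  assumes "finite S" and H: "\<And>i r. H i $ r = (\<Sum>e\<in>S. (q i e * x e $ r) *s x e)"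
  shows "mixed_disc H = (\<Sum>g | \<forall>i. g i \<in> S. (\<Prod>i\<in>UNIV. q i (g i)) * (det (\<chi> i. x (g i)))\<^sup>2)"
proof -
  let ?G = "{g :: 'n \<Rightarrow> 'e. \<forall>i. g i \<in> S}"
  have "det (\<chi> r. H (p r) $ r) =
     (\<Sum>g\<in>?G. (\<Prod>i\<in>UNIV. q i (g i)) * det (\<chi> i. x (g i)) *
        (of_int (sign p) * (\<Prod>r\<in>UNIV. x (g (p r)) $ r)))"
    if p: "p permutes UNIV" for p :: "'n \<Rightarrow> 'n"
  proof -
    have "det (\<chi> r. H (p r) $ r) =
        (\<Sum>f\<in>?G. det (\<chi> r. (q (p r) (f r) * x (f r) $ r) *s x (f r)))"
      unfolding H
      using det_rows_sum[OF \<open>finite S\<close>, of "\<lambda>r e. (q (p r) e * x e $ r) *s x e"] by simp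
    also have "\<dots> = (\<Sum>g\<in>?G. det (\<chi> r. (q (p r) (g (p r)) * x (g (p r)) $ r) *s x (g (p r))))"
      by (rule sum.reindex_bij_witness[where i="\<lambda>g. g \<circ> p" and j="\<lambda>f. f \<circ> inv p"])
        (use p in \<open>auto simp: o_def permutes_inverses\<close>)
    also have "\<dots> = (\<Sum>g\<in>?G. (\<Prod>i\<in>UNIV. q i (g i)) * det (\<chi> i. x (g i)) *
        (of_int (sign p) * (\<Prod>r\<in>UNIV. x (g (p r)) $ r)))"
    proof (intro sum.cong refl)
      fix g :: "'n \<Rightarrow> 'e"
      have "det (\<chi> r. x (g (p r))) = of_int (sign p) * det (\<chi> i. x (g i))"
        using det_permute_rows[OF p, of "\<chi> i. x (g i)"] by simp
      moreover have "(\<Prod>r\<in>UNIV. q (p r) (g (p r))) = (\<Prod>i\<in>UNIV. q i (g i))"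
        by (rule prod.reindex_bij_betw) (use p permutes_bij in auto)
      ultimately show "det (\<chi> r. (q (p r) (g (p r)) * x (g (p r)) $ r) *s x (g (p r))) =
        (\<Prod>i\<in>UNIV. q i (g i)) * det (\<chi> i. x (g i)) *
        (of_int (sign p) * (\<Prod>r\<in>UNIV. x (g (p r)) $ r))"
        unfolding det_rows_mul by (simp add: prod.distrib)
    qed
    finally show ?thesis .
  qed
  then have "mixed_disc H = (\<Sum>p | p permutes UNIV. \<Sum>g\<in>?G. (\<Prod>i\<in>UNIV. q i (g i)) *
        det (\<chi> i. x (g i)) * (of_int (sign p) * (\<Prod>r\<in>UNIV. x (g (p r)) $ r)))"
    by (simp add: mixed_disc_def)
  also have "\<dots> = (\<Sum>g\<in>?G. (\<Prod>i\<in>UNIV. q i (g i)) * det (\<chi> i. x (g i)) *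
        (\<Sum>p | p permutes UNIV. of_int (sign p) * (\<Prod>r\<in>UNIV. x (g (p r)) $ r)))"
    by (subst sum.swap) (simp add: sum_distrib_left)
  also have "\<dots> = (\<Sum>g\<in>?G. (\<Prod>i\<in>UNIV. q i (g i)) * (det (\<chi> i. x (g i)))\<^sup>2)"
  proof (intro sum.cong refl)
    fix g :: "'n \<Rightarrow> 'e"
    have "(\<Sum>p | p permutes UNIV. of_int (sign p) * (\<Prod>r\<in>UNIV. x (g (p r)) $ r)) =
        det (transpose (\<chi> i. x (g i)))"
      by (simp add: det_def transpose_def)
    then show "(\<Prod>i\<in>UNIV. q i (g i)) * det (\<chi> i. x (g i)) *
        (\<Sum>p | p permutes UNIV. of_int (sign p) * (\<Prod>r\<in>UNIV. x (g (p r)) $ r)) =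
        (\<Prod>i\<in>UNIV. q i (g i)) * (det (\<chi> i. x (g i)))\<^sup>2"
      by (simp add: det_transpose power2_eq_square)
  qed
  finally show ?thesis .
qed

lemma mixed_disc_const: "mixed_disc (\<lambda>_::'n::finite. H) = fact CARD('n) * det H"
  by (simp add: mixed_disc_def card_permutations)

lemma mixed_disc_linear:
  fixes H :: "'n::finite \<Rightarrow> real^'n^'n"
  shows "mixed_disc (H(i := s *\<^sub>R H i + t *\<^sub>R K)) = s * mixed_disc H + t * mixed_disc (H(i := K))"
proof -
  have "det (\<chi> r. (H(i := s *\<^sub>R H i + t *\<^sub>R K)) (p r) $ r) =
     s * det (\<chi> r. H (p r) $ r) + t * det (\<chi> r. (H(i := K)) (p r) $ r)"
    if p: "p permutes UNIV" for p :: "'n \<Rightarrow> 'n"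
  proof -
    \<comment> \<open>The only row that the summand of \<open>p\<close> takes from the argument
      \<open>i\<close>.\<close>
    let ?k = "inv p i"
    have k: "p r = i \<longleftrightarrow> r = ?k" for r
      using p by (metis permutes_inv_eq)
    have "(\<chi> r. (H(i := s *\<^sub>R H i + t *\<^sub>R K)) (p r) $ r) =
       (\<chi> r. if r = ?k then s *s (H i $ r) + t *s (K $ r) else H (p r) $ r)"
      by (simp add: vec_eq_iff k)
    moreover have "(\<chi> r. H (p r) $ r) = (\<chi> r. if r = ?k then H i $ r else H (p r) $ r)"
      "(\<chi> r. (H(i := K)) (p r) $ r) = (\<chi> r. if r = ?k then K $ r else H (p r) $ r)"
      using p by (auto simp add: vec_eq_iff k permutes_inverses)
    ultimately show ?thesis
      by (simp add: det_row_add det_row_mul)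
  qed
  then show ?thesis
    by (simp add: mixed_disc_def sum_distrib_left sum.distrib)
qed

subsection \<open>Gibbs averages of a finite point configuration\<close>

definition index_pairs :: "nat \<Rightarrow> (nat \<times> nat) set" where
  "index_pairs N = {(k, l). k < l \<and> l < N}"

text \<open>Zero weights are allowed so that one list of points serves several polytopes at once:
  each polytope is selected by its positive weights, and letting weights tend to 0 passes from one
  polytope to a smaller one.\<close>

definition weights :: "nat \<Rightarrow> (nat \<Rightarrow> real) \<Rightarrow> bool" where
  "weights N c \<longleftrightarrow> (\<forall>k<N. 0 \<le> c k) \<and> (\<exists>k<N. 0 < c k)"

definition gibbs_Z :: "(nat \<Rightarrow> real^'n::finite) \<Rightarrow> nat \<Rightarrow> (nat \<Rightarrow> real) \<Rightarrow> real^'n \<Rightarrow> real" where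
  "gibbs_Z a N c u = (\<Sum>k<N. c k * exp (a k \<bullet> u))"

definition gibbs :: "(nat \<Rightarrow> real^'n::finite) \<Rightarrow> nat \<Rightarrow> (nat \<Rightarrow> real) \<Rightarrow> real^'n \<Rightarrow> nat \<Rightarrow> real" where
  "gibbs a N c u k = c k * exp (a k \<bullet> u) / gibbs_Z a N c u"

definition gibbs_mean :: "(nat \<Rightarrow> real^'n::finite) \<Rightarrow> nat \<Rightarrow> (nat \<Rightarrow> real) \<Rightarrow> real^'n \<Rightarrow> real^'n" where
  "gibbs_mean a N c u = (\<Sum>k<N. gibbs a N c u k *\<^sub>R a k)"

text \<open>The covariance matrix of the distribution \<open>gibbs\<close>, in the form that runs
  over unordered pairs of points. This form has the rank-one shape required by
  \<open>mixed_disc_rank_one\<close>, with vectors that are integral for lattice points.\<close>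

definition gibbs_cov :: "(nat \<Rightarrow> real^'n::finite) \<Rightarrow> nat \<Rightarrow> (nat \<Rightarrow> real) \<Rightarrow> real^'n \<Rightarrow> real^'n^'n" where
  "gibbs_cov a N c u = (\<chi> r. \<Sum>e\<in>index_pairs N.
     (gibbs a N c u (fst e) * gibbs a N c u (snd e) * (a (fst e) - a (snd e)) $ r) *s (a (fst e) - a (snd e)))"

definition support_hull :: "(nat \<Rightarrow> real^'n::finite) \<Rightarrow> nat \<Rightarrow> (nat \<Rightarrow> real) \<Rightarrow> (real^'n) set" where
  "support_hull a N c = convex hull (a ` {k. k < N \<and> c k > 0})"

lemma finite_index_pairs [simp]: "finite (index_pairs N)"
  by (rule finite_subset[of _ "{..<N} \<times> {..<N}"]) (auto simp: index_pairs_def)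

lemma index_pairs_less: "e \<in> index_pairs N \<Longrightarrow> fst e < N" "e \<in> index_pairs N \<Longrightarrow> snd e < N"
  by (auto simp: index_pairs_def)

lemma sum_square_index_pairs:
  fixes F :: "nat \<Rightarrow> nat \<Rightarrow> 'a::real_vector"
  shows "(\<Sum>k<N. \<Sum>l<N. F k l) = (\<Sum>k<N. F k k) + (\<Sum>e\<in>index_pairs N. F (fst e) (snd e) + F (snd e) (fst e))"
proof -
  let ?L = "{(k, l). l < k \<and> k < N}" and ?D = "{(k, l). l = k \<and> k < N}"
  have sq: "{..<N} \<times> {..<N} = ?D \<union> (index_pairs N \<union> ?L)"
    by (auto simp: index_pairs_def)
  have fin: "finite ?L" "finite ?D"
    by (auto intro: finite_subset[of _ "{..<N} \<times> {..<N}"])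
  have "(\<Sum>k<N. \<Sum>l<N. F k l) = (\<Sum>e\<in>{..<N} \<times> {..<N}. F (fst e) (snd e))"
    by (simp add: sum.cartesian_product split_def)
  also have "\<dots> = (\<Sum>e\<in>?D. F (fst e) (snd e)) + ((\<Sum>e\<in>index_pairs N. F (fst e) (snd e)) + (\<Sum>e\<in>?L. F (fst e) (snd e)))"
  proof -
    have "?D \<inter> (index_pairs N \<union> ?L) = {}" "index_pairs N \<inter> ?L = {}"
      by (auto simp: index_pairs_def)
    then show ?thesis
      unfolding sq using fin by (simp add: sum.union_disjoint)
  qed
  also have "(\<Sum>e\<in>?D. F (fst e) (snd e)) = (\<Sum>k<N. F k k)"
    by (rule sum.reindex_bij_witness[where i="\<lambda>k. (k, k)" and j=fst]) auto
  also have "(\<Sum>e\<in>?L. F (fst e) (snd e)) = (\<Sum>e\<in>index_pairs N. F (snd e) (fst e))"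
    by (rule sum.reindex_bij_witness[where i=prod.swap and j=prod.swap]) (auto simp: index_pairs_def)
  finally show ?thesis
    by (simp add: sum.distrib)
qed

context
  fixes a :: "nat \<Rightarrow> real^'n::finite" and N :: nat and c :: "nat \<Rightarrow> real"
  assumes c: "weights N c"
begin

lemma gibbs_Z_pos: "gibbs_Z a N c u > 0"
proof -
  obtain k where "k < N" "0 < c k"
    using c by (auto simp: weights_def)
  then show ?thesis
    unfolding gibbs_Z_def using c by (intro sum_pos2[of _ k]) (auto simp: weights_def)
qed

lemma gibbs_nonneg: "k < N \<Longrightarrow> 0 \<le> gibbs a N c u k"
  using c gibbs_Z_pos[of u] by (simp add: gibbs_def weights_def)

lemma gibbs_pos: "0 < c k \<Longrightarrow> 0 < gibbs a N c u k"
  using gibbs_Z_pos[of u] by (simp add: gibbs_def)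

lemma sum_gibbs: "(\<Sum>k<N. gibbs a N c u k) = 1"
  using gibbs_Z_pos[of u] by (simp add: gibbs_def gibbs_Z_def flip: sum_divide_distrib)

lemma gibbs_mean_in_support_hull: "gibbs_mean a N c u \<in> support_hull a N c"
proof -
  let ?K = "{k. k < N \<and> c k > 0}"
  have "gibbs_mean a N c u = (\<Sum>k\<in>?K. gibbs a N c u k *\<^sub>R a k)"
    unfolding gibbs_mean_def using c
    by (intro sum.mono_neutral_right) (auto simp: gibbs_def weights_def order.order_iff_strict)
  moreover have "(\<Sum>k\<in>?K. gibbs a N c u k) = 1"
    unfolding sum_gibbs[of u, symmetric] using c
    by (intro sum.mono_neutral_left) (auto simp: gibbs_def weights_def order.order_iff_strict)
  ultimately show ?thesis
    unfolding support_hull_def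
    by (simp, intro convex_sum) (auto intro!: hull_inc gibbs_nonneg)
qed

lemma has_derivative_gibbs_Z:
  "(gibbs_Z a N c has_derivative (\<lambda>h. gibbs_Z a N c u * (gibbs_mean a N c u \<bullet> h))) (at u)"
proof -
  have "(gibbs_Z a N c has_derivative (\<lambda>h. \<Sum>k<N. c k * (exp (a k \<bullet> u) * (a k \<bullet> h)))) (at u)"
    unfolding gibbs_Z_def by (auto intro!: derivative_eq_intros simp: mult_ac)
  moreover have "(\<Sum>k<N. c k * (exp (a k \<bullet> u) * (a k \<bullet> h))) = gibbs_Z a N c u * (gibbs_mean a N c u \<bullet> h)" for h
    using gibbs_Z_pos[of u]
    by (simp add: gibbs_mean_def gibbs_def inner_sum_left sum_distrib_left mult_ac)
  ultimately show ?thesis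
    by simp
qed

lemma has_derivative_ln_gibbs_Z:
  "((\<lambda>u. ln (gibbs_Z a N c u)) has_derivative (\<lambda>h. gibbs_mean a N c u \<bullet> h)) (at u)"
  using gibbs_Z_pos[of u]
  by (auto intro!: derivative_eq_intros has_derivative_gibbs_Z simp: field_simps)

lemma has_derivative_gibbs:
  "((\<lambda>u. gibbs a N c u k) has_derivative (\<lambda>h. gibbs a N c u k * ((a k - gibbs_mean a N c u) \<bullet> h))) (at u)"
proof -
  have "gibbs_Z a N c u \<noteq> 0"
    using gibbs_Z_pos[of u] by simp
  then show ?thesis
    unfolding gibbs_def
    by (auto intro!: derivative_eq_intros has_derivative_gibbs_Z simp: field_simps inner_diff_left power2_eq_square)
qed

lemma gibbs_cov_mult:
  "gibbs_cov a N c u *v h = (\<Sum>e\<in>index_pairs N. (gibbs a N c u (fst e) * gibbs a N c u (snd e) *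
     ((a (fst e) - a (snd e)) \<bullet> h)) *\<^sub>R (a (fst e) - a (snd e)))"
proof -
  have "(gibbs_cov a N c u *v h) $ r = (\<Sum>e\<in>index_pairs N. (gibbs a N c u (fst e) * gibbs a N c u (snd e) *
     ((a (fst e) - a (snd e)) \<bullet> h)) *\<^sub>R (a (fst e) - a (snd e))) $ r" for r
    unfolding matrix_vector_mult_def gibbs_cov_def
    by (simp add: sum_distrib_right, subst sum.swap)
       (simp add: inner_vec_def sum_distrib_left sum_distrib_right algebra_simps)
  then show ?thesis
    by (simp add: vec_eq_iff)
qed

lemma has_derivative_gibbs_mean:
  "(gibbs_mean a N c has_derivative (\<lambda>h. gibbs_cov a N c u *v h)) (at u)"
proof -
  let ?p = "gibbs a N c u"
  have "(gibbs_mean a N c has_derivative (\<lambda>h. \<Sum>k<N. (?p k * ((a k - gibbs_mean a N c u) \<bullet> h)) *\<^sub>R a k)) (at u)"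
    unfolding gibbs_mean_def[of _ _ _ "_::real^'n", abs_def]
    by (auto intro!: derivative_eq_intros has_derivative_gibbs simp: gibbs_mean_def)
  moreover have "(\<Sum>k<N. (?p k * ((a k - gibbs_mean a N c u) \<bullet> h)) *\<^sub>R a k) = gibbs_cov a N c u *v h" for h
  proof -
    \<comment> \<open>The diagonal terms vanish, and \<open>?F k l + ?F l k\<close> is the
      contribution of the pair to the covariance applied to \<open>h\<close>.\<close>
    let ?F = "\<lambda>k l. (?p k * ?p l * ((a k - a l) \<bullet> h)) *\<^sub>R a k"
    have "(a k - gibbs_mean a N c u) \<bullet> h = (\<Sum>l<N. ?p l * ((a k - a l) \<bullet> h))" for k
      by (simp add: gibbs_mean_def inner_diff_left inner_sum_left right_diff_distrib sum_subtractf
          sum_gibbs flip: sum_distrib_right)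
    then have "(\<Sum>k<N. (?p k * ((a k - gibbs_mean a N c u) \<bullet> h)) *\<^sub>R a k) = (\<Sum>k<N. \<Sum>l<N. ?F k l)"
      by (simp add: sum_distrib_left scaleR_sum_left mult_ac)
    also have "\<dots> = gibbs_cov a N c u *v h"
      unfolding sum_square_index_pairs gibbs_cov_mult
      by (simp, intro sum.cong refl) (simp add: algebra_simps inner_diff_left)
    finally show ?thesis .
  qed
  ultimately show ?thesis
    by simp
qed

lemma inner_gibbs_cov:
  "h \<bullet> (gibbs_cov a N c u *v h) = (\<Sum>e\<in>index_pairs N. gibbs a N c u (fst e) * gibbs a N c u (snd e) *
     ((a (fst e) - a (snd e)) \<bullet> h)\<^sup>2)"
  by (simp add: gibbs_cov_mult inner_sum_right power2_eq_square inner_commute mult_ac)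

lemma gibbs_cov_nonneg: "0 \<le> h \<bullet> (gibbs_cov a N c u *v h)"
  unfolding inner_gibbs_cov
  by (intro sum_nonneg mult_nonneg_nonneg gibbs_nonneg) (auto simp: index_pairs_def)

text \<open>The quadratic form is a positively weighted sum of squares over the supported points; if
  it vanished, they would all lie in one hyperplane orthogonal to \<open>h\<close>, and the hull
  would have empty interior.\<close>

lemma gibbs_cov_pos:
  assumes "interior (support_hull a N c) \<noteq> {}" "h \<noteq> 0"
  shows "0 < h \<bullet> (gibbs_cov a N c u *v h)"
proof -
  obtain m where m: "m < N" "0 < c m"
    using c by (auto simp: weights_def)
  have "\<exists>k<N. c k > 0 \<and> a k \<bullet> h \<noteq> a m \<bullet> h"
  proof (rule ccontr)
    assume "\<not> ?thesis"
    then have "support_hull a N c \<subseteq> {x. h \<bullet> x = h \<bullet> a m}"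
      unfolding support_hull_def by (intro hull_minimal convex_hyperplane) (auto simp: inner_commute)
    then have "interior (support_hull a N c) \<subseteq> interior {x. h \<bullet> x = h \<bullet> a m}"
      by (rule interior_mono)
    also have "\<dots> = {}"
      using assms by (simp add: interior_hyperplane)
    finally show False
      using assms by simp
  qed
  then obtain k where k: "k < N" "c k > 0" "a k \<bullet> h \<noteq> a m \<bullet> h"
    by blast
  define e where "e = (if k < m then (k, m) else (m, k))"
  have "e \<in> index_pairs N"
    using k m by (auto simp: e_def index_pairs_def intro: le_neq_trans)
  moreover have "0 < gibbs a N c u (fst e) * gibbs a N c u (snd e) * ((a (fst e) - a (snd e)) \<bullet> h)\<^sup>2"
    using k m gibbs_pos by (auto simp: e_def inner_diff_left)
  moreover have "0 \<le> gibbs a N c u (fst e) * gibbs a N c u (snd e) * ((a (fst e) - a (snd e)) \<bullet> h)\<^sup>2"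
    if "e \<in> index_pairs N" for e
    using that by (intro mult_nonneg_nonneg gibbs_nonneg) (auto simp: index_pairs_def)
  ultimately show ?thesis
    unfolding inner_gibbs_cov by (intro sum_pos2[of _ e]) auto
qed

text \<open>Each single summand bounds \<open>gibbs_Z\<close> from below, so
  \<open>ln (gibbs_Z a N c u)\<close> dominates the support function of the hull up to a constant
  independent of \<open>u\<close>. This is the source of coercivity in the surjectivity
  argument.\<close>

lemma support_hull_bound:
  obtains C where "\<And>u y. y \<in> support_hull a N c \<Longrightarrow> y \<bullet> u \<le> ln (gibbs_Z a N c u) + C"
proof
  let ?C = "\<Sum>k<N. \<bar>ln (c k)\<bar>"
  fix u y assume y: "y \<in> support_hull a N c"
  have "a k \<bullet> u \<le> ln (gibbs_Z a N c u) + ?C" if k: "k < N" "c k > 0" for k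
  proof -
    have "c k * exp (a k \<bullet> u) \<le> gibbs_Z a N c u"
      unfolding gibbs_Z_def using c k by (intro member_le_sum) (auto simp: weights_def)
    then have "ln (c k * exp (a k \<bullet> u)) \<le> ln (gibbs_Z a N c u)"
      using k gibbs_Z_pos[of u] by (subst ln_le_cancel_iff) auto
    moreover have "\<bar>ln (c k)\<bar> \<le> ?C"
      using k by (intro member_le_sum) auto
    ultimately show ?thesis
      using k by (simp add: ln_mult)
  qed
  then have "support_hull a N c \<subseteq> {y. u \<bullet> y \<le> ln (gibbs_Z a N c u) + ?C}"
    unfolding support_hull_def by (intro hull_minimal convex_halfspace_le) (auto simp: inner_commute)
  then show "y \<bullet> u \<le> ln (gibbs_Z a N c u) + ?C"
    using y by (auto simp: inner_commute)
qed

end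

text \<open>All summands use the same difference vectors, so the sum is again of rank-one form with
  nonnegative coefficients. With all arguments equal, the mixed discriminant is a factorial times
  the determinant.\<close>

lemma det_sum_gibbs_cov_nonneg:
  fixes a :: "nat \<Rightarrow> real^'n::finite"
  assumes "finite J" "\<And>j. j \<in> J \<Longrightarrow> 0 \<le> t j" "\<And>j. j \<in> J \<Longrightarrow> weights N (c j)"
  shows "0 \<le> det (\<Sum>j\<in>J. t j *\<^sub>R gibbs_cov a N (c j) u)"
proof -
  define q where "q e = (\<Sum>j\<in>J. t j * (gibbs a N (c j) u (fst e) * gibbs a N (c j) u (snd e)))" for e
  define H where "H = (\<Sum>j\<in>J. t j *\<^sub>R gibbs_cov a N (c j) u)"
  have q: "0 \<le> q e" if "e \<in> index_pairs N" for e
    using that unfolding q_def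
    by (intro sum_nonneg mult_nonneg_nonneg gibbs_nonneg assms) (auto simp: index_pairs_def)
  have H: "H $ r = (\<Sum>e\<in>index_pairs N. (q e * (a (fst e) - a (snd e)) $ r) *s (a (fst e) - a (snd e)))" for r
  proof -
    have "H $ r = (\<Sum>j\<in>J. \<Sum>e\<in>index_pairs N. (t j * (gibbs a N (c j) u (fst e) * gibbs a N (c j) u (snd e)) *
        (a (fst e) - a (snd e)) $ r) *s (a (fst e) - a (snd e)))"
      by (simp add: H_def gibbs_cov_def vec_eq_iff sum_distrib_left mult.assoc right_diff_distrib)
    also have "\<dots> = (\<Sum>e\<in>index_pairs N. (q e * (a (fst e) - a (snd e)) $ r) *s (a (fst e) - a (snd e)))"
      by (subst sum.swap) (simp add: q_def vec_eq_iff sum_distrib_right sum_subtractf)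
    finally show ?thesis .
  qed
  have "fact CARD('n) * det H = (\<Sum>g | \<forall>i::'n. g i \<in> index_pairs N. (\<Prod>i\<in>UNIV. q (g i)) *
      (det (\<chi> i. a (fst (g i)) - a (snd (g i))))\<^sup>2)"
    unfolding mixed_disc_const[symmetric, where 'n = 'n]
    using mixed_disc_rank_one[of "index_pairs N" "\<lambda>_. H" "\<lambda>_. q" "\<lambda>e. a (fst e) - a (snd e)"] H by simp
  also have "\<dots> \<ge> 0"
    by (intro sum_nonneg mult_nonneg_nonneg prod_nonneg) (auto intro: q)
  finally show ?thesis
    using fact_gt_zero[of "CARD('n)", where 'a=real] by (auto simp: H_def zero_le_mult_iff)
qed

section \<open>Minkowski sums, and their volume as an integral of a Hessian determinant\<close>

lemma set_sum_memI: "finite J \<Longrightarrow> (\<And>j. j \<in> J \<Longrightarrow> f j \<in> S j) \<Longrightarrow> sum f J \<in> sum S J"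
  by (auto simp: set_sum_alt)

lemma set_sum_memE:
  assumes "x \<in> sum S J" "finite J"
  obtains f where "\<And>j. j \<in> J \<Longrightarrow> f j \<in> S j" "x = sum f J"
  using assms by (auto simp: set_sum_alt)

lemma convex_set_sum:
  fixes S :: "'j \<Rightarrow> 'a::real_vector set"
  assumes "finite J" "\<And>j. j \<in> J \<Longrightarrow> convex (S j)"
  shows "convex (sum S J)"
  using assms by (induction J rule: finite_induct) (auto intro: convex_set_plus)

lemma bounded_set_plus:
  fixes S T :: "'a::real_normed_vector set"
  assumes "bounded S" "bounded T"
  shows "bounded (S + T)"
  by (rule bounded_subset[OF bounded_plus[OF assms]]) (auto simp: set_plus_def)

lemma bounded_set_sum:
  fixes S :: "'j \<Rightarrow> 'a::real_normed_vector set"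
  assumes "finite J" "\<And>j. j \<in> J \<Longrightarrow> bounded (S j)"
  shows "bounded (sum S J)"
  using assms by (induction J rule: finite_induct) (auto intro: bounded_set_plus)

lemma compact_support_hull: "compact (support_hull a N c)"
  unfolding support_hull_def by (intro finite_imp_compact_convex_hull) auto

lemma convex_support_hull: "convex (support_hull a N c)"
  by (simp add: support_hull_def)

text \<open>A change of variables along the gradient map \<open>G\<close>, whose image fills the
  Minkowski sum up to a null set. One full-dimensional hull suffices, because its definite Hessian
  makes the sum of semidefinite ones definite. The coefficients \<open>t\<close> are there for the
  linearity of mixed volumes.\<close>

theorem has_integral_det_gibbs_cov:
  fixes a :: "nat \<Rightarrow> real^'n::{finite,wellorder}"
  assumes J: "finite J" and t: "\<And>j. j \<in> J \<Longrightarrow> 0 < t j" and c: "\<And>j. j \<in> J \<Longrightarrow> weights N (c j)"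
    and m: "m \<in> J" "interior (support_hull a N (c m)) \<noteq> {}"
  shows "((\<lambda>u. det (\<Sum>j\<in>J. t j *\<^sub>R gibbs_cov a N (c j) u)) has_integral
           measure lebesgue (\<Sum>j\<in>J. (*\<^sub>R) (t j) ` support_hull a N (c j))) UNIV"
proof -
  define K where "K = (\<Sum>j\<in>J. (*\<^sub>R) (t j) ` support_hull a N (c j))"
  define G where "G u = (\<Sum>j\<in>J. t j *\<^sub>R gibbs_mean a N (c j) u)" for u
  define H where "H u = (\<Sum>j\<in>J. t j *\<^sub>R gibbs_cov a N (c j) u)" for u
  have H_mult: "H u *v h = (\<Sum>j\<in>J. t j *\<^sub>R (gibbs_cov a N (c j) u *v h))" for u h
    unfolding H_def using J
    by (induction J rule: finite_induct) (auto simp: matrix_vector_mult_add_rdistrib scaleR_matrix_vector_assoc)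
  have G': "(G has_derivative (\<lambda>h. H u *v h)) (at u)" for u
    unfolding G_def H_mult using c
    by (intro has_derivative_sum has_derivative_scaleR_right has_derivative_gibbs_mean) auto
  have H_pos: "0 < h \<bullet> (H u *v h)" if "h \<noteq> 0" for u h
  proof -
    have "0 < t m * (h \<bullet> (gibbs_cov a N (c m) u *v h))"
      using gibbs_cov_pos[OF c m(2) that] m t by simp
    moreover have "0 \<le> t j * (h \<bullet> (gibbs_cov a N (c j) u *v h))" if "j \<in> J" for j
      by (intro mult_nonneg_nonneg gibbs_cov_nonneg c less_imp_le[OF t] that)
    ultimately show ?thesis
      unfolding H_mult using J m by (auto simp: inner_sum_right intro!: sum_pos2[of _ m])
  qed
  \<comment> \<open>Strict monotonicity of the gradient of a strictly convex function: along the
    segment from \<open>u\<close> to \<open>v\<close>, the component of \<open>G\<close> in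
    direction \<open>v - u\<close> has positive derivative.\<close>
  have inj: "inj G"
  proof (rule injI, rule ccontr)
    fix u v assume eq: "G u = G v" and ne: "u \<noteq> v"
    have "\<exists>z. (0::real) < z \<and> z < 1 \<and>
       (v - u) \<bullet> G (u + 1 *\<^sub>R (v - u)) - (v - u) \<bullet> G (u + 0 *\<^sub>R (v - u)) = (1 - 0) * ((v - u) \<bullet> (H (u + z *\<^sub>R (v - u)) *v (v - u)))"
    proof (rule MVT2)
      fix s :: real
      have "((\<lambda>s. (v - u) \<bullet> G (u + s *\<^sub>R (v - u))) has_derivative
          (\<lambda>d. (v - u) \<bullet> (H (u + s *\<^sub>R (v - u)) *v (d *\<^sub>R (v - u))))) (at s)"
        by (auto intro!: derivative_eq_intros has_derivative_compose[where g=G, OF _ G'])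
      then show "((\<lambda>s. (v - u) \<bullet> G (u + s *\<^sub>R (v - u))) has_real_derivative
          (v - u) \<bullet> (H (u + s *\<^sub>R (v - u)) *v (v - u))) (at s)"
        by (simp add: has_field_derivative_def matrix_vector_mult_scaleR mult_commute_abs)
    qed auto
    then obtain z where "(v - u) \<bullet> (H (u + z *\<^sub>R (v - u)) *v (v - u)) = 0"
      using eq by auto
    moreover have "0 < (v - u) \<bullet> (H (u + z *\<^sub>R (v - u)) *v (v - u))"
      using H_pos ne by simp
    ultimately show False
      by simp
  qed
  have sub: "range G \<subseteq> K"
    unfolding K_def G_def using c J by (auto intro!: set_sum_memI gibbs_mean_in_support_hull)
  have "interior K \<subseteq> range G"
  proof
    fix x assume "x \<in> interior K"
    then obtain r where r: "r > 0" "cball x r \<subseteq> K"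
      by (meson mem_interior_cball)
    \<comment> \<open>Its gradient is \<open>G u - x\<close>, so every minimizer is a preimage of
      \<open>x\<close>; a minimizer exists by coercivity.\<close>
    define \<Psi> where "\<Psi> u = (\<Sum>j\<in>J. t j * ln (gibbs_Z a N (c j) u)) - x \<bullet> u" for u
    have \<Psi>': "(\<Psi> has_derivative (\<lambda>h. (G u - x) \<bullet> h)) (at u)" for u
    proof -
      have "((\<lambda>u. (\<Sum>j\<in>J. t j * ln (gibbs_Z a N (c j) u)) - x \<bullet> u) has_derivative
          (\<lambda>h. (\<Sum>j\<in>J. t j * (gibbs_mean a N (c j) u \<bullet> h)) - x \<bullet> h)) (at u)"
        by (intro has_derivative_diff has_derivative_sum has_derivative_mult_right
            has_derivative_ln_gibbs_Z c has_derivative_inner_right has_derivative_ident)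
      then show ?thesis
        unfolding \<Psi>_def by (simp add: G_def inner_diff_left inner_sum_left)
    qed
    have "\<forall>j\<in>J. \<exists>C. \<forall>u. \<forall>y \<in> support_hull a N (c j). y \<bullet> u \<le> ln (gibbs_Z a N (c j) u) + C"
      using support_hull_bound[OF c] by metis
    then obtain C where C: "\<And>j u y. j \<in> J \<Longrightarrow> y \<in> support_hull a N (c j) \<Longrightarrow> y \<bullet> u \<le> ln (gibbs_Z a N (c j) u) + C j"
      by metis
    define C' where "C' = (\<Sum>j\<in>J. t j * C j)"
    have coercive: "r * norm u - C' \<le> \<Psi> u" for u
    proof -
      \<comment> \<open>The point of the ball around \<open>x\<close> farthest in direction
        \<open>u\<close>; it gains \<open>r * norm u\<close> over \<open>x\<close>. For
        \<open>u = 0\<close> the division by zero yields \<open>y = x\<close>, which is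
        consistent.\<close>
      define y where "y = x + (r / norm u) *\<^sub>R u"
      have "y \<in> K"
        using r by (intro subsetD[OF r(2)]) (auto simp: y_def dist_norm)
      then obtain f where f: "\<And>j. j \<in> J \<Longrightarrow> f j \<in> (*\<^sub>R) (t j) ` support_hull a N (c j)" "y = sum f J"
        unfolding K_def using J set_sum_memE by blast
      have "f j \<bullet> u \<le> t j * (ln (gibbs_Z a N (c j) u) + C j)" if "j \<in> J" for j
        using f(1)[OF that] C[OF that, of _ u] t[OF that] by auto
      then have "y \<bullet> u \<le> (\<Sum>j\<in>J. t j * (ln (gibbs_Z a N (c j) u) + C j))"
        unfolding f(2) inner_sum_left by (intro sum_mono)
      moreover have "y \<bullet> u = x \<bullet> u + r * norm u"
        by (simp add: y_def inner_add_left dot_square_norm power2_eq_square)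
      ultimately show ?thesis
        by (simp add: \<Psi>_def C'_def algebra_simps sum.distrib)
    qed
    \<comment> \<open>Outside this radius the coercive bound already exceeds
      \<open>\<Psi> 0\<close>, so a minimum over the ball is global.\<close>
    define R where "R = max 0 ((\<Psi> 0 + C') / r)"
    then have R0: "0 \<le> R"
      by simp
    have "continuous_on (cball 0 R) \<Psi>"
      by (intro continuous_at_imp_continuous_on ballI has_derivative_continuous[OF \<Psi>'])
    then obtain u where u: "u \<in> cball 0 R" "\<And>v. v \<in> cball 0 R \<Longrightarrow> \<Psi> u \<le> \<Psi> v"
      using continuous_attains_inf[of "cball 0 R" \<Psi>] R0 by auto
    have "\<Psi> u \<le> \<Psi> v" for v
    proof (cases "v \<in> cball 0 R")
      case False
      then have "(\<Psi> 0 + C') / r < norm v"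
        by (auto simp: R_def)
      then have "\<Psi> 0 \<le> \<Psi> v"
        using coercive[of v] r by (simp add: field_simps)
      moreover have "\<Psi> u \<le> \<Psi> 0"
        by (rule u) (auto simp: R_def)
      ultimately show ?thesis by simp
    qed (use u in auto)
    then have "(\<lambda>h. (G u - x) \<bullet> h) = (\<lambda>h. 0)"
      by (intro differential_zero_maxmin[OF _ _ \<Psi>', of u UNIV]) auto
    then have "(G u - x) \<bullet> (G u - x) = 0"
      by (rule fun_cong)
    then show "x \<in> range G"
      by (auto simp: image_iff)
  qed
  \<comment> \<open>The range lies between the interior of \<open>K\<close> and \<open>K\<close>,
    and the frontier of a convex set is null.\<close>
  then have neg: "negligible (sym_diff K (range G))"
    using sub unfolding K_def
    by (intro negligible_subset[OF negligible_convex_frontier[of K]])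
      (auto simp: K_def frontier_def J convex_set_sum convex_scaling convex_support_hull intro: subsetD[OF closure_subset])
  have "K \<in> lmeasurable"
    unfolding K_def
    by (intro measurable_convex convex_set_sum bounded_set_sum bounded_scaling convex_scaling J)
      (auto simp: compact_imp_bounded compact_support_hull convex_support_hull)
  then have "range G \<in> lmeasurable \<and> measure lebesgue (range G) = measure lebesgue K"
    using lmeasurable_negligible_symdiff[OF _ neg] measure_negligible_symdiff[OF _ neg] by simp
  then have "((\<lambda>u. \<bar>det (matrix (\<lambda>h. H u *v h))\<bar>) has_integral measure lebesgue K) UNIV"
    by (subst has_measure_differentiable_image[symmetric]) (use G' inj in auto)
  moreover have "0 \<le> det (H u)" for u
    unfolding H_def using J t c by (intro det_sum_gibbs_cov_nonneg) (auto intro: less_imp_le)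
  ultimately show ?thesis
    by (simp add: H_def K_def matrix_of_matrix_vector_mul)
qed

subsection \<open>Mixed volumes as integrals of mixed discriminants\<close>

text \<open>Normalized so that equal convex bodies give \<open>n!\<close> times their volume, the
  normalization in which lattice polytopes have integer values. The two factorials in
  \<open>rel_mixed_volume\<close> and \<open>rel_volume\<close> cancel to the same
  convention.\<close>

definition mixed_volume :: "('n::finite \<Rightarrow> (real^'n) set) \<Rightarrow> real" where
  "mixed_volume P = (\<Sum>I\<in>UNIV. (-1) ^ (CARD('n) - card I) * measure lebesgue (\<Sum>i\<in>I. P i))"

lemma has_integral_mixed_disc:
  fixes H :: "'n::finite \<Rightarrow> real^'n \<Rightarrow> real^'n^'n"
  assumes "\<And>I. I \<noteq> {} \<Longrightarrow> ((\<lambda>u. det (\<Sum>i\<in>I. H i u)) has_integral measure lebesgue (\<Sum>i\<in>I. P i)) UNIV"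
  shows "((\<lambda>u. mixed_disc (\<lambda>i. H i u)) has_integral mixed_volume P) UNIV"
proof -
  have "((\<lambda>u. det (\<Sum>i\<in>I. H i u)) has_integral measure lebesgue (\<Sum>i\<in>I. P i)) UNIV" for I
  proof (cases "I = {}")
    case True
    have "det (0 :: real^'n^'n) = 0"
      by (intro det_zero_row(2)) (auto simp: row_def vec_eq_iff)
    then show ?thesis
      using True negligible_imp_measure0[of "{0 :: real^'n}"] by (simp add: set_zero)
  qed (use assms in auto)
  then show ?thesis
    unfolding mixed_disc_polarization[symmetric] mixed_volume_def
    by (intro has_integral_sum has_integral_mult_right) auto
qed

lemma finite_functions_into: "finite S \<Longrightarrow> finite {g :: 'n::finite \<Rightarrow> 'e. \<forall>i. g i \<in> S}"
  using finite_PiE[of "UNIV :: 'n set" "\<lambda>_. S"] by (simp add: PiE_def Pi_def)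

lemma mixed_disc_gibbs_cov:
  fixes a :: "nat \<Rightarrow> real^'n::finite"
  shows "mixed_disc (\<lambda>i. gibbs_cov a N (c i) u) = (\<Sum>g | \<forall>i. g i \<in> index_pairs N.
     (\<Prod>i\<in>UNIV. gibbs a N (c i) u (fst (g i)) * gibbs a N (c i) u (snd (g i))) *
     (det (\<chi> i. a (fst (g i)) - a (snd (g i))))\<^sup>2)"
  by (rule mixed_disc_rank_one[where x="\<lambda>e. a (fst e) - a (snd e)"
        and q="\<lambda>i e. gibbs a N (c i) u (fst e) * gibbs a N (c i) u (snd e)"])
    (simp_all add: gibbs_cov_def)

lemma mixed_disc_gibbs_cov_nonneg:
  assumes "\<And>i. weights N (c i)"
  shows "0 \<le> mixed_disc (\<lambda>i. gibbs_cov a N (c i) u)"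
  unfolding mixed_disc_gibbs_cov
  by (intro sum_nonneg mult_nonneg_nonneg prod_nonneg gibbs_nonneg assms ballI)
    (auto intro: index_pairs_less)

lemma has_integral_mixed_volume:
  fixes a :: "nat \<Rightarrow> real^'n::{finite,wellorder}"
  assumes "\<And>i. weights N (c i)" "\<And>i. interior (support_hull a N (c i)) \<noteq> {}"
  shows "((\<lambda>u. mixed_disc (\<lambda>i. gibbs_cov a N (c i) u)) has_integral
           mixed_volume (\<lambda>i. support_hull a N (c i))) UNIV"
proof (rule has_integral_mixed_disc)
  fix I :: "'n set" assume "I \<noteq> {}"
  then obtain m where "m \<in> I" by blast
  then show "((\<lambda>u. det (\<Sum>i\<in>I. gibbs_cov a N (c i) u)) has_integral
      measure lebesgue (\<Sum>i\<in>I. support_hull a N (c i))) UNIV"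
    using has_integral_det_gibbs_cov[of I "\<lambda>_. 1" N c m a] assms by simp
qed

lemma mixed_volume_linear_support_hull:
  fixes a :: "nat \<Rightarrow> real^'n::{finite,wellorder}"
  assumes c: "\<And>i. weights N (c i)" "weights N d"
    and int: "\<And>i. interior (support_hull a N (c i)) \<noteq> {}" "interior (support_hull a N d) \<noteq> {}"
    and st: "0 < s" "0 < t"
  defines "P \<equiv> \<lambda>i. support_hull a N (c i)" and "Q \<equiv> support_hull a N d"
  shows "mixed_volume (P(m := (*\<^sub>R) s ` P m + (*\<^sub>R) t ` Q)) =
         s * mixed_volume P + t * mixed_volume (P(m := Q))"
proof -
  define H where "H u = (\<lambda>i. gibbs_cov a N (c i) u)" for u
  define K where "K u = gibbs_cov a N d u" for u
  have "((\<lambda>u. mixed_disc (\<lambda>i. ((H u)(m := s *\<^sub>R H u m + t *\<^sub>R K u)) i)) has_integral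
      mixed_volume (P(m := (*\<^sub>R) s ` P m + (*\<^sub>R) t ` Q))) UNIV"
  proof (rule has_integral_mixed_disc)
    fix I :: "'n set" assume I: "I \<noteq> {}"
    show "((\<lambda>u. det (\<Sum>i\<in>I. ((H u)(m := s *\<^sub>R H u m + t *\<^sub>R K u)) i)) has_integral
      measure lebesgue (\<Sum>i\<in>I. (P(m := (*\<^sub>R) s ` P m + (*\<^sub>R) t ` Q)) i)) UNIV"
    proof (cases "m \<in> I")
      case False
      obtain j where "j \<in> I"
        using I by blast
      moreover have "(\<Sum>i\<in>I. ((H u)(m := s *\<^sub>R H u m + t *\<^sub>R K u)) i) = (\<Sum>i\<in>I. gibbs_cov a N (c i) u)" for u
        using False by (intro sum.cong) (auto simp: H_def)
      moreover have "(\<Sum>i\<in>I. (P(m := (*\<^sub>R) s ` P m + (*\<^sub>R) t ` Q)) i) = (\<Sum>i\<in>I. support_hull a N (c i))"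
        using False by (intro sum.cong) (auto simp: P_def)
      ultimately show ?thesis
        using has_integral_det_gibbs_cov[of I "\<lambda>_. 1" N c j a] assms by simp
    next
      case True
      \<comment> \<open>The argument at \<open>m\<close> is itself a sum of two bodies. The index
        \<open>None\<close> carries the extra summand \<open>t Q\<close>, which turns the whole into
        one weighted Minkowski sum.\<close>
      define J where "J = insert None (Some ` I)"
      define c' where "c' = case_option d c"
      define t' where "t' = case_option t (\<lambda>i. if i = m then s else 1)"
      have I': "I = insert m (I - {m})"
        using True by blast
      have "(\<Sum>j\<in>J. t' j *\<^sub>R gibbs_cov a N (c' j) u) = (\<Sum>i\<in>I. ((H u)(m := s *\<^sub>R H u m + t *\<^sub>R K u)) i)" for u
      proof -
        have "(\<Sum>j\<in>J. t' j *\<^sub>R gibbs_cov a N (c' j) u) = t *\<^sub>R K u + (\<Sum>i\<in>I. (if i = m then s else 1) *\<^sub>R H u i)"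
          by (simp add: J_def sum.reindex t'_def c'_def H_def K_def)
        also have "\<dots> = (\<Sum>i\<in>I. ((H u)(m := s *\<^sub>R H u m + t *\<^sub>R K u)) i)"
          by (subst (1 2) I', subst (1 2) sum.insert) (auto simp: ac_simps intro!: sum.cong)
        finally show ?thesis .
      qed
      moreover have "(\<Sum>j\<in>J. (*\<^sub>R) (t' j) ` support_hull a N (c' j)) = (\<Sum>i\<in>I. (P(m := (*\<^sub>R) s ` P m + (*\<^sub>R) t ` Q)) i)"
      proof -
        have "(\<Sum>j\<in>J. (*\<^sub>R) (t' j) ` support_hull a N (c' j)) = (*\<^sub>R) t ` Q + (\<Sum>i\<in>I. (*\<^sub>R) (if i = m then s else 1) ` P i)"
          by (simp add: J_def sum.reindex t'_def c'_def P_def Q_def)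
        also have "\<dots> = (\<Sum>i\<in>I. (P(m := (*\<^sub>R) s ` P m + (*\<^sub>R) t ` Q)) i)"
          by (subst (1 2) I', subst (1 2) sum.insert) (auto simp: ac_simps intro!: sum.cong)
        finally show ?thesis .
      qed
      moreover have "((\<lambda>u. det (\<Sum>j\<in>J. t' j *\<^sub>R gibbs_cov a N (c' j) u)) has_integral
           measure lebesgue (\<Sum>j\<in>J. (*\<^sub>R) (t' j) ` support_hull a N (c' j))) UNIV"
        by (rule has_integral_det_gibbs_cov[of _ _ _ _ None])
          (use assms in \<open>auto simp: J_def t'_def c'_def split: if_splits\<close>)
      ultimately show ?thesis
        by simp
    qed
  qed
  moreover have "((\<lambda>u. mixed_disc (\<lambda>i. ((H u)(m := s *\<^sub>R H u m + t *\<^sub>R K u)) i)) has_integral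
      (s * mixed_volume P + t * mixed_volume (P(m := Q)))) UNIV"
  proof -
    have "P(m := Q) = (\<lambda>i. support_hull a N ((c(m := d)) i))"
      by (simp add: P_def Q_def fun_eq_iff)
    moreover have "(H u)(m := K u) = (\<lambda>i. gibbs_cov a N ((c(m := d)) i) u)" for u
      by (auto simp: H_def K_def)
    ultimately have "((\<lambda>u. mixed_disc ((H u)(m := K u))) has_integral mixed_volume (P(m := Q))) UNIV"
      using has_integral_mixed_volume[of N "c(m := d)" a] assms by simp
    moreover have "((\<lambda>u. mixed_disc (H u)) has_integral mixed_volume P) UNIV"
      unfolding H_def P_def by (intro has_integral_mixed_volume assms)
    ultimately show ?thesis
      by (simp only: mixed_disc_linear) (intro has_integral_add has_integral_mult_right)
  qed
  ultimately show ?thesis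
    by (rule has_integral_unique)
qed

lemma tendsto_gibbs:
  assumes "weights N c" "\<And>k. ((\<lambda>m. c' m k) \<longlongrightarrow> c k) F"
  shows "((\<lambda>m. gibbs a N (c' m) u k) \<longlongrightarrow> gibbs a N c u k) F"
  unfolding gibbs_def using gibbs_Z_pos[OF assms(1), of a u] assms(2)
  by (intro tendsto_intros) (auto simp: gibbs_Z_def intro!: tendsto_intros)

text \<open>Adding a vanishing multiple of \<open>c'\<close> to \<open>c\<close> yields weights
  whose hull is that of \<open>c'\<close>, since the points of \<open>c\<close> already lie in it.
  Their integrals are therefore constant, while the integrands converge to that of
  \<open>c\<close>.\<close>

lemma mixed_volume_mono_support_hull:
  fixes a :: "nat \<Rightarrow> real^'n::{finite,wellorder}"
  assumes c: "\<And>i. weights N (c i)" and c': "\<And>i. weights N (c' i)"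
    and int: "\<And>i. interior (support_hull a N (c i)) \<noteq> {}"
    and sub: "\<And>i. support_hull a N (c i) \<subseteq> support_hull a N (c' i)"
  shows "mixed_volume (\<lambda>i. support_hull a N (c i)) \<le> mixed_volume (\<lambda>i. support_hull a N (c' i))"
proof -
  define d where "d m i k = c i k + inverse (real (Suc m)) * c' i k" for m i k
  have d: "weights N (d m i)" for m i
    using c[of i] c'[of i] by (auto simp: weights_def d_def add_pos_nonneg)
  have hull: "support_hull a N (d m i) = support_hull a N (c' i)" for m i
  proof -
    have "{k. k < N \<and> d m i k > 0} = {k. k < N \<and> c i k > 0} \<union> {k. k < N \<and> c' i k > 0}"
    proof -
      have "d m i k > 0 \<longleftrightarrow> c i k > 0 \<or> c' i k > 0" if "k < N" for k
      proof -
        have "0 \<le> c i k" "0 \<le> c' i k"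
          using c[of i] c'[of i] that by (auto simp: weights_def)
        then show ?thesis
          unfolding d_def
          by (auto simp: zero_less_mult_iff add_pos_nonneg add_nonneg_pos order.order_iff_strict)
      qed
      then show ?thesis by auto
    qed
    moreover have "a ` {k. k < N \<and> c i k > 0} \<subseteq> convex hull (a ` {k. k < N \<and> c' i k > 0})"
      using sub[of i] hull_subset unfolding support_hull_def by (rule subset_trans[rotated])
    ultimately show ?thesis
      unfolding support_hull_def image_Un
      by (intro antisym hull_mono hull_minimal) (auto intro: hull_inc)
  qed
  define f where "f u = mixed_disc (\<lambda>i. gibbs_cov a N (c i) u)" for u
  define h where "h m u = mixed_disc (\<lambda>i. gibbs_cov a N (d m i) u)" for m u
  have f: "(f has_integral mixed_volume (\<lambda>i. support_hull a N (c i))) UNIV"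
    unfolding f_def using c int by (rule has_integral_mixed_volume)
  have h: "(h m has_integral mixed_volume (\<lambda>i. support_hull a N (c' i))) UNIV" for m
  proof -
    have "interior (support_hull a N (c' i)) \<noteq> {}" for i
      using int[of i] interior_mono[OF sub[of i]] by blast
    then show ?thesis
      using has_integral_mixed_volume[of N "d m" a] d hull unfolding h_def[abs_def] by simp
  qed
  have f0: "0 \<le> f u" and h0: "0 \<le> h m u" for m u
    unfolding f_def h_def using c d by (simp_all add: mixed_disc_gibbs_cov_nonneg)
  have fa: "f absolutely_integrable_on UNIV" and ha: "h m absolutely_integrable_on UNIV" for m
    using f h f0 h0 by (auto intro!: nonnegative_absolutely_integrable_1)
  have "(\<lambda>m. d m i k) \<longlonglongrightarrow> c i k" for i k
    unfolding d_def
    by (rule tendsto_eq_intros refl LIMSEQ_inverse_real_of_nat)+ simp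
  then have lim: "(\<lambda>m. h m u) \<longlonglongrightarrow> f u" for u
    unfolding h_def f_def mixed_disc_gibbs_cov by (intro tendsto_intros tendsto_gibbs c)
  \<comment> \<open>Fatou in the form of dominated convergence: the minimum is dominated by
    \<open>f\<close>, tends to \<open>f\<close>, and its integral is at most that of
    \<open>h m\<close>.\<close>
  have min: "(\<lambda>u. min (f u) (h m u)) absolutely_integrable_on UNIV" for m
    using fa ha by (rule absolutely_integrable_min_1)
  have conv: "(\<lambda>m. integral UNIV (\<lambda>u. min (f u) (h m u))) \<longlonglongrightarrow> integral UNIV f"
  proof (rule dominated_convergence(2))
    show "(\<lambda>u. min (f u) (h m u)) integrable_on UNIV" for m
      using min by (rule set_lebesgue_integral_eq_integral)
    show "f integrable_on UNIV"
      using f by blast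
    show "norm (min (f u) (h m u)) \<le> f u" for m u
      using f0 h0 by auto
    show "(\<lambda>m. min (f u) (h m u)) \<longlonglongrightarrow> f u" for u
      using tendsto_min[OF tendsto_const lim, of "f u" u] by simp
  qed
  have "integral UNIV (\<lambda>u. min (f u) (h m u)) \<le> mixed_volume (\<lambda>i. support_hull a N (c' i))" for m
    using integral_le[of "\<lambda>u. min (f u) (h m u)" UNIV "h m"] min[of m] h[of m]
    by (auto simp: set_lebesgue_integral_eq_integral(1) integral_unique has_integral_integrable)
  then have "integral UNIV f \<le> mixed_volume (\<lambda>i. support_hull a N (c' i))"
    using conv by (intro LIMSEQ_le_const2[OF conv]) blast
  then show ?thesis
    using integral_unique[OF f] by simp
qed

subsection \<open>Integrality by a tropical limit\<close>

lemma has_derivative_vec: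
  fixes f :: "real^'m::finite \<Rightarrow> real^'n::finite"
  assumes "\<And>i. ((\<lambda>z. f z $ i) has_derivative (\<lambda>h. f' h $ i)) (at x)"
  shows "(f has_derivative f') (at x)"
  unfolding has_derivative_componentwise_within[of f f' x UNIV]
  using assms by (auto simp: Basis_vec_def inner_axis)

lemma matrix_mult_matrix_inv: "invertible A \<Longrightarrow> A ** matrix_inv A = mat 1"
  unfolding matrix_inv_def invertible_def by (metis (mono_tags, lifting) someI_ex)

text \<open>The derivative of the logistic function \<open>exp y / (1 + exp y)\<close>. It is also
  the product of the two Gibbs probabilities of a two-point configuration whose exponents differ by
  \<open>y\<close>.\<close>

definition logistic_density :: "real \<Rightarrow> real" where
  "logistic_density y = exp y / (1 + exp y)\<^sup>2"

text \<open>Applying the logistic function to each \<open>x i \<bullet> z\<close> maps the space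
  bijectively onto the open unit cube; the Jacobian is the integrand times the absolute
  determinant.\<close>

lemma has_integral_prod_logistic_density:
  fixes x :: "'n::{finite,wellorder} \<Rightarrow> real^'n::_"
  assumes det: "det (\<chi> i. x i) \<noteq> 0"
  shows "((\<lambda>z. \<Prod>i\<in>UNIV. logistic_density (x i \<bullet> z)) has_integral 1 / \<bar>det (\<chi> i. x i)\<bar>) UNIV"
proof -
  let ?\<sigma> = "\<lambda>y::real. 1 - 1 / (1 + exp y)"
  define X where "X = (\<chi> i. x i)"
  define G where "G z = (\<chi> i. ?\<sigma> (x i \<bullet> z))" for z
  define G' where "G' z = (\<chi> i. logistic_density (x i \<bullet> z) *s x i)" for z
  have pos: "1 + exp y > (0::real)" for y
    by (simp add: add_pos_pos)
  have X: "(X *v z) $ i = x i \<bullet> z" for z i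
    by (simp add: X_def matrix_vector_mul_component)
  have inv: "invertible X"
    using det by (simp add: X_def invertible_det_nz)
  have G'_mult: "(G' z *v h) $ i = logistic_density (x i \<bullet> z) * (x i \<bullet> h)" for z h i
    by (simp add: G'_def matrix_vector_mul_component inner_vec_def sum_distrib_left mult.assoc)
  have "(G has_derivative (\<lambda>h. G' z *v h)) (at z)" for z
  proof (rule has_derivative_vec)
    fix i
    have "1 + exp (x i \<bullet> z) \<noteq> 0"
      using pos[of "x i \<bullet> z"] by simp
    then show "((\<lambda>z. G z $ i) has_derivative (\<lambda>h. (G' z *v h) $ i)) (at z)"
      unfolding G'_mult unfolding G_def
      by (auto intro!: derivative_eq_intros simp: logistic_density_def power2_eq_square field_simps)
  qed
  moreover have "inj G"
  proof (rule injI)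
    fix z w assume eq: "G z = G w"
    have "(X *v z) $ i = (X *v w) $ i" for i
    proof -
      have "?\<sigma> (x i \<bullet> z) = ?\<sigma> (x i \<bullet> w)"
        using arg_cong[OF eq, of "\<lambda>v. v $ i"] by (simp add: G_def)
      then show ?thesis
        using pos[of "x i \<bullet> z"] pos[of "x i \<bullet> w"] by (simp add: X)
    qed
    then have "X *v z = X *v w"
      by (simp add: vec_eq_iff)
    then show "z = w"
      using inv by (metis invertible_def matrix_vector_mul_assoc matrix_vector_mul_lid)
  qed
  moreover have "range G = box 0 1"
  proof (intro antisym subsetI)
    fix y assume "y \<in> range G"
    then show "y \<in> box 0 1"
      using pos by (auto simp: G_def mem_box_cart field_simps)
  next
    fix y :: "real^'n::_" assume "y \<in> box 0 1"
    then have y: "0 < y $ i" "y $ i < 1" for i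
      by (auto simp: mem_box_cart)
    define z where "z = matrix_inv X *v (\<chi> i. ln (y $ i / (1 - y $ i)))"
    have "X *v z = (\<chi> i. ln (y $ i / (1 - y $ i)))"
      unfolding z_def by (simp add: matrix_vector_mul_assoc matrix_mult_matrix_inv[OF inv])
    then have "x i \<bullet> z = ln (y $ i / (1 - y $ i))" for i
      using X[of z i] by simp
    moreover have "1 + y $ i / (1 - y $ i) = 1 / (1 - y $ i)" for i
      using y(2)[of i] by (simp add: field_simps)
    ultimately have "G z = y"
      using y by (simp add: G_def vec_eq_iff)
    then show "y \<in> range G"
      by blast
  qed
  moreover have "measure lebesgue (box 0 (1 :: real^'n::_)) = 1"
    by (simp add: measure_lborel_box_eq) (auto simp: Basis_vec_def inner_axis intro!: prod.neutral)
  ultimately have "((\<lambda>z. \<bar>det (matrix (\<lambda>h. G' z *v h))\<bar>) has_integral 1) UNIV"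
    by (subst has_measure_differentiable_image[symmetric]) auto
  moreover have "\<bar>det (G' z)\<bar> = (\<Prod>i\<in>UNIV. logistic_density (x i \<bullet> z)) * \<bar>det X\<bar>" for z
  proof -
    have "0 \<le> (\<Prod>i\<in>UNIV. logistic_density (x i \<bullet> z))"
      by (intro prod_nonneg) (auto simp: logistic_density_def)
    then show ?thesis
      unfolding G'_def X_def det_rows_mul by (simp add: abs_mult)
  qed
  ultimately have "((\<lambda>z. (\<Prod>i\<in>UNIV. logistic_density (x i \<bullet> z)) * \<bar>det X\<bar>) has_integral 1) UNIV"
    by (simp add: matrix_of_matrix_vector_mul)
  then have "((\<lambda>z. (\<Prod>i\<in>UNIV. logistic_density (x i \<bullet> z)) * \<bar>det X\<bar> * (1 / \<bar>det X\<bar>)) has_integral 1 * (1 / \<bar>det X\<bar>)) UNIV"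
    by (rule has_integral_mult_left)
  then show ?thesis
    using det by (simp add: X_def)
qed

lemma logistic_density_diff: "logistic_density (x - y) = exp (x + y) / (exp x + exp y)\<^sup>2"
  by (simp add: logistic_density_def exp_diff exp_add power2_eq_square field_simps)

text \<open>Only the terms \<open>k\<close> and \<open>l\<close> of the denominator, which do not
  depend on \<open>s\<close>, are kept. The resulting bound is uniform in \<open>s\<close> and so
  dominates the tropical family.\<close>

lemma ratio_le_logistic_density:
  fixes b :: "nat \<Rightarrow> real"
  assumes "finite T" "k \<in> T" "l \<in> T" "k \<noteq> l" "e k = 0" "e l = 0"
  shows "exp (b k + b l) / (\<Sum>j\<in>T. exp (b j + s * e j))\<^sup>2 \<le> logistic_density (b k - b l)"
proof -
  have "exp (b k) + exp (b l) = (\<Sum>j\<in>{k, l}. exp (b j + s * e j))"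
    using assms by simp
  also have "\<dots> \<le> (\<Sum>j\<in>T. exp (b j + s * e j))"
    using assms by (intro sum_mono2) auto
  finally show ?thesis
    unfolding logistic_density_diff
    by (intro divide_left_mono power_mono mult_pos_pos zero_less_power) (auto simp: add_pos_pos less_le_trans[of _ "exp (b k) + exp (b l)"])
qed

text \<open>Here \<open>e j\<close> is the excess of the affine form of \<open>j\<close> over the
  common value of \<open>k\<close> and \<open>l\<close>. A positive excess makes the denominator
  explode, a negative one dies out, and a zero excess elsewhere is excluded. The limit is nonzero
  exactly when \<open>k\<close> and \<open>l\<close> attain the tropical maximum.\<close>

lemma ratio_tendsto:
  fixes b :: "nat \<Rightarrow> real"
  assumes T: "finite T" "k \<in> T" "l \<in> T" "k \<noteq> l" "e k = 0" "e l = 0"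
    and ne: "\<And>j. j \<in> T - {k, l} \<Longrightarrow> e j \<noteq> 0"
  shows "(\<lambda>m. exp (b k + b l) / (\<Sum>j\<in>T. exp (b j + real m * e j))\<^sup>2)
     \<longlonglongrightarrow> (if \<exists>j\<in>T. e j > 0 then 0 else logistic_density (b k - b l))"
proof (cases "\<exists>j\<in>T. e j > 0")
  case True
  then obtain j where j: "j \<in> T" "e j > 0"
    by blast
  have "filterlim (\<lambda>m. real m * e j) at_top sequentially"
    by (rule filterlim_at_top_mult_tendsto_pos[OF tendsto_const j(2) filterlim_real_sequentially])
  then have "filterlim (\<lambda>m. exp (b j + real m * e j)) at_top sequentially"
    by (rule filterlim_compose[OF exp_at_top filterlim_tendsto_add_at_top[OF tendsto_const]])
  then have "filterlim (\<lambda>m. \<Sum>j\<in>T. exp (b j + real m * e j)) at_top sequentially"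
    by (rule filterlim_at_top_mono) (use T j in \<open>auto intro!: always_eventually member_le_sum\<close>)
  then have "filterlim (\<lambda>m. (\<Sum>j\<in>T. exp (b j + real m * e j))\<^sup>2) at_top sequentially"
    by (intro filterlim_pow_at_top) auto
  then have "(\<lambda>m. exp (b k + b l) / (\<Sum>j\<in>T. exp (b j + real m * e j))\<^sup>2) \<longlonglongrightarrow> 0"
    by (intro tendsto_divide_0[OF tendsto_const] filterlim_at_top_imp_at_infinity)
  then show ?thesis
    using True by simp
next
  case False
  have "(\<lambda>m. exp (b j + real m * e j)) \<longlonglongrightarrow> (if j \<in> {k, l} then exp (b j) else 0)" if "j \<in> T" for j
  proof (cases "j \<in> {k, l}")
    case False
    then have "e j < 0"
      using ne[of j] that \<open>\<not> (\<exists>j\<in>T. e j > 0)\<close> by force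
    then have "filterlim (\<lambda>m. e j * real m) at_bot sequentially"
      by (rule filterlim_tendsto_neg_mult_at_bot[OF tendsto_const _ filterlim_real_sequentially])
    then have "(\<lambda>m. exp (e j * real m)) \<longlonglongrightarrow> 0"
      by (rule filterlim_compose[OF exp_at_bot])
    then have "(\<lambda>m. exp (b j) * exp (e j * real m)) \<longlonglongrightarrow> 0"
      by (rule tendsto_mult_right_zero)
    then have "(\<lambda>m. exp (b j + real m * e j)) \<longlonglongrightarrow> 0"
      by (simp add: exp_add mult.commute)
    then show ?thesis
      using False by simp
  qed (use T in auto)
  then have "(\<lambda>m. \<Sum>j\<in>T. exp (b j + real m * e j)) \<longlonglongrightarrow> (\<Sum>j\<in>T. if j \<in> {k, l} then exp (b j) else 0)"
    by (rule tendsto_sum)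
  also have "(\<Sum>j\<in>T. if j \<in> {k, l} then exp (b j) else 0) = (\<Sum>j\<in>{k, l}. exp (b j))"
    using T by (intro sum.mono_neutral_cong_right) auto
  also have "\<dots> = exp (b k) + exp (b l)"
    using T by simp
  finally have "(\<lambda>m. exp (b k + b l) / (\<Sum>j\<in>T. exp (b j + real m * e j))\<^sup>2)
      \<longlonglongrightarrow> exp (b k + b l) / (exp (b k) + exp (b l))\<^sup>2"
    by (intro tendsto_intros) (auto simp: add_pos_pos[THEN less_imp_neq, symmetric])
  then show ?thesis
    using False by (simp add: logistic_density_diff)
qed

text \<open>Finitely many proper hyperplanes do not cover the space. Along a line from a point good
  for the old functionals, in a direction good for the new one, each functional vanishes for at most
  one \<open>t\<close>.\<close>

lemma exists_common_nonzero:
  fixes F :: "(('x \<Rightarrow> real) \<Rightarrow> real) set"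
  assumes "finite F" "\<And>f \<omega> \<eta> t. f \<in> F \<Longrightarrow> f (\<lambda>i. \<omega> i + t * \<eta> i) = f \<omega> + t * f \<eta>"
    and "\<And>f. f \<in> F \<Longrightarrow> \<exists>\<eta>. f \<eta> \<noteq> 0"
  shows "\<exists>\<omega>. \<forall>f\<in>F. f \<omega> \<noteq> 0"
  using assms
proof (induction F rule: finite_induct)
  case (insert g F)
  have "\<exists>\<omega>. \<forall>f\<in>F. f \<omega> \<noteq> 0"
    by (rule insert.IH) (use insert.prems in simp_all)
  then obtain \<omega> where \<omega>: "\<forall>f\<in>F. f \<omega> \<noteq> 0"
    by (rule exE)
  obtain \<eta> where \<eta>: "g \<eta> \<noteq> 0"
    using insert.prems(2)[of g] by auto
  have "finite {t. f \<omega> + t * f \<eta> = 0}" if "f \<in> insert g F" for f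
  proof (rule finite_subset)
    show "{t. f \<omega> + t * f \<eta> = 0} \<subseteq> {- f \<omega> / f \<eta>}"
      using that \<omega> \<eta> by (cases "f \<eta> = 0") (auto simp: field_simps add_eq_0_iff)
  qed simp
  then have "finite (\<Union>f\<in>insert g F. {t. f \<omega> + t * f \<eta> = 0})"
    using insert.hyps by blast
  then obtain t where "t \<notin> (\<Union>f\<in>insert g F. {t. f \<omega> + t * f \<eta> = 0})"
    using ex_new_if_finite[OF infinite_UNIV_char_0] by blast
  then show ?case
    using insert.prems(1) by (intro exI[of _ "\<lambda>i. \<omega> i + t * \<eta> i"]) auto
qed simp

lemma det_Ints:
  fixes A :: "real^'n::finite^'n"
  assumes "\<And>i j. A $ i $ j \<in> \<int>"
  shows "det A \<in> \<int>"
  unfolding det_def using assms by (intro Ints_sum Ints_mult Ints_prod) auto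

text \<open>The support is \<open>T\<close> for every \<open>s\<close>, so the polytope, and with it
  the mixed volume, stays fixed during the degeneration.\<close>

definition tropical_weights :: "nat set \<Rightarrow> (nat \<Rightarrow> real) \<Rightarrow> real \<Rightarrow> nat \<Rightarrow> real" where
  "tropical_weights T \<omega> s k = (if k \<in> T then exp (s * \<omega> k) else 0)"

text \<open>After the shift by \<open>s *\<^sub>R y\<close>, the exponential of \<open>s\<close>
  times the common tropical value of \<open>k\<close> and \<open>l\<close> factors out of numerator
  and denominator and cancels.\<close>

lemma gibbs_tropical_product:
  fixes a :: "nat \<Rightarrow> real^'n::finite"
  assumes T: "T \<subseteq> {..<N}" "k \<in> T" "l \<in> T" and eq: "a k \<bullet> y + \<omega> k = a l \<bullet> y + \<omega> l"
  shows "gibbs a N (tropical_weights T \<omega> s) (z + s *\<^sub>R y) k * gibbs a N (tropical_weights T \<omega> s) (z + s *\<^sub>R y) l =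
    exp (a k \<bullet> z + a l \<bullet> z) / (\<Sum>j\<in>T. exp (a j \<bullet> z + s * (a j \<bullet> y + \<omega> j - (a k \<bullet> y + \<omega> k))))\<^sup>2"
proof -
  define \<mu> where "\<mu> = a k \<bullet> y + \<omega> k"
  define D where "D = (\<Sum>j\<in>T. exp (a j \<bullet> z + s * (a j \<bullet> y + \<omega> j - \<mu>)))"
  have factor: "exp (s * \<omega> j) * exp (a j \<bullet> (z + s *\<^sub>R y)) = exp (s * \<mu>) * exp (a j \<bullet> z + s * (a j \<bullet> y + \<omega> j - \<mu>))" for j
    by (simp add: inner_add_right algebra_simps flip: exp_add)
  have "gibbs_Z a N (tropical_weights T \<omega> s) (z + s *\<^sub>R y) = (\<Sum>j\<in>T. exp (s * \<omega> j) * exp (a j \<bullet> (z + s *\<^sub>R y)))"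
    unfolding gibbs_Z_def tropical_weights_def using T
    by (intro sum.mono_neutral_cong_right) auto
  also have "\<dots> = exp (s * \<mu>) * D"
    by (simp add: factor D_def sum_distrib_left)
  finally have Z: "gibbs_Z a N (tropical_weights T \<omega> s) (z + s *\<^sub>R y) = exp (s * \<mu>) * D" .
  have "gibbs a N (tropical_weights T \<omega> s) (z + s *\<^sub>R y) j = exp (a j \<bullet> z) / D" if "j \<in> {k, l}" for j
  proof -
    have "a j \<bullet> y + \<omega> j = \<mu>" "j \<in> T"
      using that eq T by (auto simp: \<mu>_def)
    then show ?thesis
      unfolding gibbs_def Z tropical_weights_def using factor[of j] by simp
  qed
  from this[of k] this[of l] show ?thesis
    unfolding \<mu>_def[symmetric] D_def[symmetric] by (simp add: exp_add power2_eq_square)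
qed

lemma borel_measurable_gibbs:
  "weights N c \<Longrightarrow> (\<lambda>u. gibbs a N c u k) \<in> borel_measurable borel"
  by (intro borel_measurable_continuous_onI continuous_at_imp_continuous_on ballI
      has_derivative_continuous[OF has_derivative_gibbs])

lemma lborel_integral_translation:
  fixes f :: "'a::euclidean_space \<Rightarrow> real"
  assumes f: "f \<in> borel_measurable borel" and int: "integrable lborel (\<lambda>z. f (z + b))"
  shows "integrable lborel f" "(\<integral>z. f (z + b) \<partial>lborel) = (\<integral>z. f z \<partial>lborel)"
proof -
  have *: "(lborel :: 'a measure) = distr lborel borel ((+) b)"
    by (simp add: lborel_distr_plus)
  have int': "integrable lborel (\<lambda>z. f (b + z))"
    using int by (simp add: add.commute)
  show "integrable lborel f"
    using f int' by (subst *) (simp add: integrable_distr_eq)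
  show "(\<integral>z. f (z + b) \<partial>lborel) = (\<integral>z. f z \<partial>lborel)"
    using f by (subst (2) *) (simp add: integral_distr add.commute)
qed

text \<open>The point \<open>y\<close> is where the tropical hypersurfaces dual to the edges \<open>g i\<close> meet. In the
  coordinate \<open>z = u - m y\<close> the integrand is dominated by a product of logistic densities, and by
  genericity it converges either to that product or to 0.\<close>

lemma tropical_limit:
  fixes a :: "nat \<Rightarrow> real^'n::{finite,wellorder}" and \<omega> :: "'n \<Rightarrow> nat \<Rightarrow> real"
  assumes T: "\<And>i. T i \<subseteq> {..<N}" "\<And>i. T i \<noteq> {}"
    and g: "\<And>i. fst (g i) \<in> T i" "\<And>i. snd (g i) \<in> T i" "\<And>i. fst (g i) \<noteq> snd (g i)"
    and det: "det (\<chi> i. a (fst (g i)) - a (snd (g i))) \<noteq> 0"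
    and y: "\<And>i. a (fst (g i)) \<bullet> y + \<omega> i (fst (g i)) = a (snd (g i)) \<bullet> y + \<omega> i (snd (g i))"
    and generic: "\<And>i j. j \<in> T i - {fst (g i), snd (g i)} \<Longrightarrow> a j \<bullet> y + \<omega> i j \<noteq> a (fst (g i)) \<bullet> y + \<omega> i (fst (g i))"
  defines "f \<equiv> \<lambda>m u. \<Prod>i\<in>UNIV. gibbs a N (tropical_weights (T i) (\<omega> i) (real m)) u (fst (g i)) *
      gibbs a N (tropical_weights (T i) (\<omega> i) (real m)) u (snd (g i))"
  shows "(\<forall>m. integrable lborel (f m)) \<and> ((\<lambda>m. \<integral>u. f m u \<partial>lborel) \<longlonglongrightarrow> 0 \<or>
     (\<lambda>m. \<integral>u. f m u \<partial>lborel) \<longlonglongrightarrow> 1 / \<bar>det (\<chi> i. a (fst (g i)) - a (snd (g i)))\<bar>)"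
proof -
  define x where "x i = a (fst (g i)) - a (snd (g i))" for i
  define e where "e i j = a j \<bullet> y + \<omega> i j - (a (fst (g i)) \<bullet> y + \<omega> i (fst (g i)))" for i j
  define r where "r i m z = exp (a (fst (g i)) \<bullet> z + a (snd (g i)) \<bullet> z) / (\<Sum>j\<in>T i. exp (a j \<bullet> z + real m * e i j))\<^sup>2"
    for i m z
  define L where "L i z = (if \<exists>j\<in>T i. e i j > 0 then 0 else logistic_density (x i \<bullet> z))" for i z
  define \<Lambda> where "\<Lambda> z = (\<Prod>i\<in>UNIV. logistic_density (x i \<bullet> z))" for z
  have fin: "finite (T i)" for i
    using T finite_subset by blast
  have w: "weights N (tropical_weights (T i) (\<omega> i) s)" for i s
    using T(1)[of i] T(2)[of i] by (auto simp: weights_def tropical_weights_def)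
  have e0: "e i (fst (g i)) = 0" "e i (snd (g i)) = 0" for i
    using y by (auto simp: e_def)
  have f: "f m (z + real m *\<^sub>R y) = (\<Prod>i\<in>UNIV. r i m z)" for m z
    unfolding f_def r_def e_def by (intro prod.cong refl gibbs_tropical_product T g y)
  have \<Lambda>_pos: "0 \<le> \<Lambda> z" for z
    unfolding \<Lambda>_def by (intro prod_nonneg) (auto simp: logistic_density_def)
  have meas_\<Lambda>: "\<Lambda> \<in> borel_measurable borel"
    unfolding \<Lambda>_def logistic_density_def by measurable
  have \<Lambda>: "(\<Lambda> has_integral 1 / \<bar>det (\<chi> i. x i)\<bar>) UNIV"
    unfolding \<Lambda>_def using det by (intro has_integral_prod_logistic_density) (simp add: x_def)
  have "integral\<^sup>N lborel \<Lambda> = ennreal (1 / \<bar>det (\<chi> i. x i)\<bar>)"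
    using \<Lambda> meas_\<Lambda> \<Lambda>_pos by (intro nn_integral_has_integral_lborel) auto
  then have int_\<Lambda>: "integrable lborel \<Lambda>" and val_\<Lambda>: "integral\<^sup>L lborel \<Lambda> = 1 / \<bar>det (\<chi> i. x i)\<bar>"
    using meas_\<Lambda> \<Lambda>_pos by (auto intro: integrableI_nonneg simp: integral_eq_nn_integral)
  have r: "0 \<le> r i m z" "r i m z \<le> logistic_density (x i \<bullet> z)" for i m z
    using ratio_le_logistic_density[where b="\<lambda>j. a j \<bullet> z" and T="T i" and e="e i", OF fin g e0]
    by (auto simp: r_def x_def inner_diff_left)
  have bound: "norm (f m (z + real m *\<^sub>R y)) \<le> \<Lambda> z" for m z
    unfolding f \<Lambda>_def using r by (auto simp: prod_nonneg intro!: prod_mono)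
  have meas_f: "f m \<in> borel_measurable borel" for m
    unfolding f_def using w by (intro borel_measurable_prod borel_measurable_times borel_measurable_gibbs)
  have meas_f': "(\<lambda>z. f m (z + real m *\<^sub>R y)) \<in> borel_measurable borel" for m
    using meas_f by measurable
  have "integrable lborel (\<lambda>z. f m (z + real m *\<^sub>R y))" for m
    using int_\<Lambda> meas_f' bound \<Lambda>_pos by (auto intro!: Bochner_Integration.integrable_bound[OF int_\<Lambda>])
  note shift = lborel_integral_translation[OF meas_f this]
  have "(\<lambda>m. r i m z) \<longlonglongrightarrow> L i z" for i z
    unfolding r_def L_def x_def inner_diff_left
    by (rule ratio_tendsto[where b="\<lambda>j. a j \<bullet> z", OF fin g e0]) (use generic[of _ i] in \<open>simp add: e_def\<close>)
  then have "(\<lambda>m. f m (z + real m *\<^sub>R y)) \<longlonglongrightarrow> (\<Prod>i\<in>UNIV. L i z)" for z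
    unfolding f by (intro tendsto_prod) auto
  moreover have "(\<lambda>z. \<Prod>i\<in>UNIV. L i z) \<in> borel_measurable borel"
    unfolding L_def logistic_density_def by measurable
  ultimately have "(\<lambda>m. \<integral>z. f m (z + real m *\<^sub>R y) \<partial>lborel) \<longlonglongrightarrow> (\<integral>z. (\<Prod>i\<in>UNIV. L i z) \<partial>lborel)"
    using int_\<Lambda> meas_f' bound by (intro integral_dominated_convergence[of _ _ _ \<Lambda>]) auto
  then have lim: "(\<lambda>m. \<integral>u. f m u \<partial>lborel) \<longlonglongrightarrow> (\<integral>z. (\<Prod>i\<in>UNIV. L i z) \<partial>lborel)"
    by (simp add: shift)
  \<comment> \<open>Whether \<open>L i\<close> is zero does not depend on \<open>z\<close>: one
    positive excess kills the product everywhere, otherwise it is all of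
    \<open>\<Lambda>\<close>.\<close>
  have "(\<integral>z. (\<Prod>i\<in>UNIV. L i z) \<partial>lborel) \<in> {0, 1 / \<bar>det (\<chi> i. x i)\<bar>}"
  proof (cases "\<exists>i. \<exists>j\<in>T i. e i j > 0")
    case True
    then have zero: "(\<Prod>i\<in>UNIV. L i z) = 0" for z
      by (auto simp: L_def)
    show ?thesis
      unfolding zero by simp
  next
    case False
    then have "(\<Prod>i\<in>UNIV. L i z) = \<Lambda> z" for z
      by (auto simp: L_def \<Lambda>_def intro!: prod.cong)
    then show ?thesis
      using val_\<Lambda> by simp
  qed
  then show ?thesis
    using shift(1) lim by (auto simp: x_def)
qed

text \<open>The mixed volume equals the integral for every parameter \<open>m\<close> of the
  degeneration, hence also its limit, which is computed separately for each choice \<open>g\<close>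
  of one pair of points per polytope.\<close>

theorem mixed_volume_support_hull_Ints:
  fixes a :: "nat \<Rightarrow> real^'n::{finite,wellorder}"
  assumes c: "\<And>i. weights N (c i)" "\<And>i. interior (support_hull a N (c i)) \<noteq> {}"
    and int: "\<And>k j. k < N \<Longrightarrow> a k $ j \<in> \<int>"
  shows "mixed_volume (\<lambda>i. support_hull a N (c i)) \<in> \<int>"
proof -
  define T where "T i = {k. k < N \<and> c i k > 0}" for i
  define x where "x g = (\<chi> i. a (fst (g i)) - a (snd (g i)))" for g :: "'n \<Rightarrow> nat \<times> nat"
  \<comment> \<open>For invertible \<open>x g\<close> this is the common point of the tropical
    hypersurfaces of the chosen pairs. It is linear in \<open>\<omega>\<close> whatever value
    \<open>matrix_inv\<close> takes on singular matrices.\<close>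
  define y where "y g \<omega> = matrix_inv (x g) *v (\<chi> i. \<omega> (i, snd (g i)) - \<omega> (i, fst (g i)))"
    for g :: "'n \<Rightarrow> nat \<times> nat" and \<omega> :: "'n \<times> nat \<Rightarrow> real"
  define \<Phi> where "\<Phi> g i j \<omega> = a j \<bullet> y g \<omega> + \<omega> (i, j) - (a (fst (g i)) \<bullet> y g \<omega> + \<omega> (i, fst (g i)))"
    for g :: "'n \<Rightarrow> nat \<times> nat" and i j and \<omega> :: "'n \<times> nat \<Rightarrow> real"
  define G where "G = {g :: 'n \<Rightarrow> nat \<times> nat. \<forall>i. g i \<in> index_pairs N}"
  have finG: "finite G"
    unfolding G_def by (simp add: finite_functions_into)
  have pair_ne: "fst (g i) \<noteq> snd (g i)" if "g \<in> G" for g i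
    using that by (auto simp: G_def index_pairs_def split: prod.splits) (metis fst_conv less_irrefl prod.collapse snd_conv)
  have y_solves: "a (fst (g i)) \<bullet> y g \<omega> + \<omega> (i, fst (g i)) = a (snd (g i)) \<bullet> y g \<omega> + \<omega> (i, snd (g i))"
    if "det (x g) \<noteq> 0" for g i \<omega>
  proof -
    have "x g *v y g \<omega> = (\<chi> i. \<omega> (i, snd (g i)) - \<omega> (i, fst (g i)))"
      using that unfolding y_def
      by (simp add: matrix_vector_mul_assoc matrix_mult_matrix_inv invertible_det_nz)
    then have "(x g *v y g \<omega>) $ i = \<omega> (i, snd (g i)) - \<omega> (i, fst (g i))"
      by simp
    then show ?thesis
      by (simp add: x_def matrix_vector_mul_component inner_diff_left)
  qed
  \<comment> \<open>The excesses that genericity must keep away from 0. Singular \<open>g\<close>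
    can be included because linearity holds for them too; their terms carry the factor
    \<open>det (x g) = 0\<close> anyway.\<close>
  define F where "F = (\<lambda>(g, i, j). \<Phi> g i j) ` {(g, i, j). g \<in> G \<and> j < N \<and> j \<notin> {fst (g i), snd (g i)}}"
  have "\<exists>\<omega>. \<forall>f\<in>F. f \<omega> \<noteq> 0"
  proof (rule exists_common_nonzero)
    have "finite {(g, i, j). g \<in> G \<and> j < N \<and> j \<notin> {fst (g i), snd (g i)}}"
      by (rule finite_subset[of _ "G \<times> UNIV \<times> {..<N}"]) (use finG in auto)
    then show "finite F"
      unfolding F_def by (rule finite_imageI)
  next
    fix f :: "('n \<times> nat \<Rightarrow> real) \<Rightarrow> real" and \<omega> \<eta> t assume "f \<in> F"
    moreover have "y g (\<lambda>p. \<omega> p + t * \<eta> p) = y g \<omega> + t *\<^sub>R y g \<eta>" for g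
    proof -
      have "(\<chi> i. (\<omega> (i, snd (g i)) + t * \<eta> (i, snd (g i))) - (\<omega> (i, fst (g i)) + t * \<eta> (i, fst (g i)))) =
        (\<chi> i. \<omega> (i, snd (g i)) - \<omega> (i, fst (g i))) + t *\<^sub>R (\<chi> i. \<eta> (i, snd (g i)) - \<eta> (i, fst (g i)))"
        by (simp add: vec_eq_iff algebra_simps)
      then show ?thesis
        by (simp add: y_def matrix_vector_right_distrib matrix_vector_mult_scaleR)
    qed
    ultimately show "f (\<lambda>p. \<omega> p + t * \<eta> p) = f \<omega> + t * f \<eta>"
      by (auto simp: F_def \<Phi>_def inner_add_right algebra_simps)
  next
    fix f assume "f \<in> F"
    then obtain g i j where f: "f = \<Phi> g i j" and j: "j \<noteq> fst (g i)" "j \<noteq> snd (g i)"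
      by (auto simp: F_def)
    \<comment> \<open>Lifting only \<open>j\<close>, which is no endpoint of the pair
      \<open>g i\<close>, leaves \<open>y\<close> at 0 and raises the excess of \<open>j\<close> to
      1.\<close>
    define \<eta> where "\<eta> p = (if p = (i, j) then 1 else 0 :: real)" for p
    have "(\<chi> k. \<eta> (k, snd (g k)) - \<eta> (k, fst (g k))) = 0"
      using j by (auto simp: vec_eq_iff \<eta>_def)
    then have "f \<eta> = 1"
      using j by (simp add: f \<Phi>_def y_def \<eta>_def)
    then show "\<exists>\<eta>. f \<eta> \<noteq> 0"
      by (metis zero_neq_one)
  qed
  then obtain \<omega> where \<omega>: "\<And>g i j. g \<in> G \<Longrightarrow> j < N \<Longrightarrow> j \<notin> {fst (g i), snd (g i)} \<Longrightarrow> \<Phi> g i j \<omega> \<noteq> 0"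
    unfolding F_def by force
  define d where "d m i = tropical_weights (T i) (\<lambda>k. \<omega> (i, k)) (real m)" for m i
  have T: "T i \<subseteq> {..<N}" "T i \<noteq> {}" for i
    using c(1)[of i] by (auto simp: T_def weights_def)
  have d: "weights N (d m i)" for m i
    using T[of i] by (auto simp: weights_def d_def tropical_weights_def)
  have hull: "support_hull a N (d m i) = support_hull a N (c i)" for m i
    unfolding support_hull_def d_def tropical_weights_def T_def
    by (intro arg_cong[where f="\<lambda>S. convex hull (a ` S)"]) auto
  define f where "f g m u = (\<Prod>i\<in>UNIV. gibbs a N (d m i) u (fst (g i)) * gibbs a N (d m i) u (snd (g i)))"
    for g :: "'n \<Rightarrow> nat \<times> nat" and m u
  define M where "M = mixed_volume (\<lambda>i. support_hull a N (c i))"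
  have "\<exists>L\<in>\<int>. (\<forall>m. integrable lborel (\<lambda>u. f g m u * (det (x g))\<^sup>2)) \<and>
      (\<lambda>m. \<integral>u. f g m u * (det (x g))\<^sup>2 \<partial>lborel) \<longlonglongrightarrow> L" if g: "g \<in> G" for g
  proof (cases "det (x g) = 0 \<or> (\<exists>i. fst (g i) \<notin> T i \<or> snd (g i) \<notin> T i)")
    case True
    have zero: "f g m u * (det (x g))\<^sup>2 = 0" for m u
    proof (cases "det (x g) = 0")
      case False
      then obtain i where "fst (g i) \<notin> T i \<or> snd (g i) \<notin> T i"
        using True by blast
      then have "gibbs a N (d m i) u (fst (g i)) * gibbs a N (d m i) u (snd (g i)) = 0"
        by (auto simp: gibbs_def d_def tropical_weights_def)
      then show ?thesis
        unfolding f_def by (subst prod_zero) auto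
    qed simp
    show ?thesis
      unfolding zero by (intro bexI[of _ 0]) auto
  next
    case False
    have x_int: "det (x g) \<in> \<int>"
      using g unfolding x_def G_def by (intro det_Ints) (auto intro!: Ints_diff int index_pairs_less)
    have "(\<forall>m. integrable lborel (f g m)) \<and> ((\<lambda>m. \<integral>u. f g m u \<partial>lborel) \<longlonglongrightarrow> 0 \<or>
        (\<lambda>m. \<integral>u. f g m u \<partial>lborel) \<longlonglongrightarrow> 1 / \<bar>det (x g)\<bar>)"
          unfolding f_def[abs_def] d_def x_def
    proof (rule tropical_limit[of T N g a "y g \<omega>" "\<lambda>i k. \<omega> (i, k)"])
      show "a j \<bullet> y g \<omega> + \<omega> (i, j) \<noteq> a (fst (g i)) \<bullet> y g \<omega> + \<omega> (i, fst (g i))"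
        if "j \<in> T i - {fst (g i), snd (g i)}" for i j
        using \<omega>[OF g, of j i] that T(1)[of i] by (auto simp: \<Phi>_def)
    qed (use False g T y_solves pair_ne in \<open>auto simp: x_def\<close>)
    then have int: "integrable lborel (\<lambda>u. f g m u * (det (x g))\<^sup>2)"
      and lim: "(\<lambda>m. \<integral>u. f g m u \<partial>lborel) \<longlonglongrightarrow> 0 \<or> (\<lambda>m. \<integral>u. f g m u \<partial>lborel) \<longlonglongrightarrow> 1 / \<bar>det (x g)\<bar>" for m
      by (auto intro: integrable_mult_left)
    \<comment> \<open>The coefficient of the term is a squared determinant and its limit mass an
      inverse determinant, so an integer remains.\<close>
    have "1 / \<bar>det (x g)\<bar> * (det (x g))\<^sup>2 = \<bar>det (x g)\<bar>"
      using False by (simp add: power2_eq_square abs_if field_simps)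
    then have "(\<lambda>m. \<integral>u. f g m u * (det (x g))\<^sup>2 \<partial>lborel) \<longlonglongrightarrow> 0 \<or>
      (\<lambda>m. \<integral>u. f g m u * (det (x g))\<^sup>2 \<partial>lborel) \<longlonglongrightarrow> \<bar>det (x g)\<bar>"
      using lim tendsto_mult_right[of _ 0 sequentially "(det (x g))\<^sup>2"]
        tendsto_mult_right[of _ "1 / \<bar>det (x g)\<bar>" sequentially "(det (x g))\<^sup>2"] by auto
    then show ?thesis
      using int x_int Ints_0 Ints_abs by blast
  qed
  then obtain L where L: "\<And>g. g \<in> G \<Longrightarrow> L g \<in> \<int>"
      "\<And>g m. g \<in> G \<Longrightarrow> integrable lborel (\<lambda>u. f g m u * (det (x g))\<^sup>2)"
      "\<And>g. g \<in> G \<Longrightarrow> (\<lambda>m. \<integral>u. f g m u * (det (x g))\<^sup>2 \<partial>lborel) \<longlonglongrightarrow> L g"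
    by metis
  have M: "M = (\<Sum>g\<in>G. \<integral>u. f g m u * (det (x g))\<^sup>2 \<partial>lborel)" for m
  proof -
    have "((\<lambda>u. mixed_disc (\<lambda>i. gibbs_cov a N (d m i) u)) has_integral M) UNIV"
      using has_integral_mixed_volume[of N "d m" a] c(2) d hull by (simp add: M_def)
    moreover have "((\<lambda>u. \<Sum>g\<in>G. f g m u * (det (x g))\<^sup>2) has_integral
        (\<Sum>g\<in>G. \<integral>u. f g m u * (det (x g))\<^sup>2 \<partial>lborel)) UNIV"
      using L finG by (intro has_integral_sum has_integral_integral_lborel) auto
    ultimately show ?thesis
      unfolding mixed_disc_gibbs_cov f_def x_def G_def by (rule has_integral_unique)
  qed
  have "(\<lambda>m. \<Sum>g\<in>G. \<integral>u. f g m u * (det (x g))\<^sup>2 \<partial>lborel) \<longlonglongrightarrow> (\<Sum>g\<in>G. L g)"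
    using L by (intro tendsto_sum) auto
  then have "(\<lambda>m::nat. M) \<longlonglongrightarrow> (\<Sum>g\<in>G. L g)"
    unfolding M[symmetric] .
  then have "M = (\<Sum>g\<in>G. L g)"
    by (simp add: LIMSEQ_const_iff)
  then show ?thesis
    using L by (auto simp: M_def intro: Ints_sum)
qed

subsection \<open>Mixed volumes of lattice polytopes\<close>

text \<open>The Gibbs construction needs one list of points for all polytopes involved; 0/1 weights
  then recover the individual hulls.\<close>

lemma exists_common_enumeration:
  fixes U :: "(real^'n::finite) set"
  assumes "finite U"
  obtains a :: "nat \<Rightarrow> real^'n" and N where "a ` {..<N} = U"
    "\<And>X. X \<subseteq> U \<Longrightarrow> X \<noteq> {} \<Longrightarrow> weights N (\<lambda>k. of_bool (a k \<in> X))"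
    "\<And>X. X \<subseteq> U \<Longrightarrow> support_hull a N (\<lambda>k. of_bool (a k \<in> X)) = convex hull X"
proof -
  obtain a where "bij_betw a {0..<card U} U"
    using ex_bij_betw_nat_finite[OF assms] by blast
  then have a: "a ` {..<card U} = U"
    by (simp add: bij_betw_def atLeast0LessThan)
  show thesis
  proof (rule that[OF a])
    fix X assume X: "X \<subseteq> U"
    have "a ` {k. k < card U \<and> (0 :: real) < of_bool (a k \<in> X)} = X"
      using X a by auto
    then show "support_hull a (card U) (\<lambda>k. of_bool (a k \<in> X)) = convex hull X"
      by (simp add: support_hull_def)
    assume "X \<noteq> {}"
    then obtain v where "v \<in> X"
      by blast
    moreover from this have "v \<in> a ` {..<card U}"
      using X a by blast
    ultimately have "\<exists>k<card U. a k \<in> X"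
      by auto
    then show "weights (card U) (\<lambda>k. of_bool (a k \<in> X))"
      by (auto simp: weights_def)
  qed
qed

context
  fixes A B :: "'n::{finite,wellorder} \<Rightarrow> (real^'n::_) set"
  assumes finite_A: "\<And>i. finite (A i)" and interior_A: "\<And>i. interior (convex hull A i) \<noteq> {}"
begin

lemma hull_source_nonempty: "A i \<noteq> {}"
  using interior_A[of i] by auto

lemma mixed_volume_mono:
  assumes B: "\<And>i. finite (B i)" and sub: "\<And>i. convex hull A i \<subseteq> convex hull B i"
  shows "mixed_volume (\<lambda>i. convex hull A i) \<le> mixed_volume (\<lambda>i. convex hull B i)"
proof -
  have "finite (\<Union>i. A i \<union> B i)"
    using finite_A B by auto
  then obtain a N where aN: "a ` {..<N} = (\<Union>i. A i \<union> B i)"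
    "\<And>X. X \<subseteq> (\<Union>i. A i \<union> B i) \<Longrightarrow> X \<noteq> {} \<Longrightarrow> weights N (\<lambda>k. of_bool (a k \<in> X))"
    "\<And>X. X \<subseteq> (\<Union>i. A i \<union> B i) \<Longrightarrow> support_hull a N (\<lambda>k. of_bool (a k \<in> X)) = convex hull X"
    by (rule exists_common_enumeration) blast
  have AB: "A i \<subseteq> (\<Union>i. A i \<union> B i)" "B i \<subseteq> (\<Union>i. A i \<union> B i)" "B i \<noteq> {}" for i
    using sub[of i] hull_source_nonempty[of i] by auto
  show ?thesis
    using mixed_volume_mono_support_hull[of N "\<lambda>i k. of_bool (a k \<in> A i)" "\<lambda>i k. of_bool (a k \<in> B i)" a]
      aN(2)[OF AB(1) hull_source_nonempty] aN(2)[OF AB(2,3)] aN(3)[OF AB(1)] aN(3)[OF AB(2)] interior_A sub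
    by simp
qed

lemma mixed_volume_Ints:
  assumes "\<And>i v j. v \<in> A i \<Longrightarrow> v $ j \<in> \<int>"
  shows "mixed_volume (\<lambda>i. convex hull A i) \<in> \<int>"
proof -
  have "finite (\<Union>i. A i)"
    using finite_A by auto
  then obtain a N where aN: "a ` {..<N} = (\<Union>i. A i)"
    "\<And>X. X \<subseteq> (\<Union>i. A i) \<Longrightarrow> X \<noteq> {} \<Longrightarrow> weights N (\<lambda>k. of_bool (a k \<in> X))"
    "\<And>X. X \<subseteq> (\<Union>i. A i) \<Longrightarrow> support_hull a N (\<lambda>k. of_bool (a k \<in> X)) = convex hull X"
    by (rule exists_common_enumeration) blast
  have A: "A i \<subseteq> (\<Union>i. A i)" for i
    by blast
  have "a k $ j \<in> \<int>" if "k < N" for k j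
    using assms that aN(1) by (metis UN_iff image_eqI lessThan_iff)
  then show ?thesis
    using mixed_volume_support_hull_Ints[of N "\<lambda>i k. of_bool (a k \<in> A i)" a]
      aN(2)[OF A hull_source_nonempty] aN(3)[OF A] interior_A by simp
qed

lemma mixed_volume_linear:
  assumes Q: "finite Q" "interior (convex hull Q) \<noteq> {}" and st: "0 < s" "0 < t"
  shows "mixed_volume ((\<lambda>i. convex hull A i)(m := (*\<^sub>R) s ` (convex hull A m) + (*\<^sub>R) t ` (convex hull Q))) =
    s * mixed_volume (\<lambda>i. convex hull A i) + t * mixed_volume ((\<lambda>i. convex hull A i)(m := convex hull Q))"
proof -
  have "finite ((\<Union>i. A i) \<union> Q)"
    using finite_A Q by auto
  then obtain a N where aN: "a ` {..<N} = (\<Union>i. A i) \<union> Q"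
    "\<And>X. X \<subseteq> (\<Union>i. A i) \<union> Q \<Longrightarrow> X \<noteq> {} \<Longrightarrow> weights N (\<lambda>k. of_bool (a k \<in> X))"
    "\<And>X. X \<subseteq> (\<Union>i. A i) \<union> Q \<Longrightarrow> support_hull a N (\<lambda>k. of_bool (a k \<in> X)) = convex hull X"
    by (rule exists_common_enumeration) blast
  have AQ: "A i \<subseteq> (\<Union>i. A i) \<union> Q" "Q \<subseteq> (\<Union>i. A i) \<union> Q" "Q \<noteq> {}" for i
    using Q by auto
  show ?thesis
    using mixed_volume_linear_support_hull[of N "\<lambda>i k. of_bool (a k \<in> A i)" "\<lambda>k. of_bool (a k \<in> Q)" a s t m]
      aN(2)[OF AQ(1) hull_source_nonempty] aN(2)[OF AQ(2,3)] aN(3)[OF AQ(1)] aN(3)[OF AQ(2)] interior_A Q st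
    by simp
qed

end

text \<open>The rise of \<^const>\<open>mixed_volume\<close> is at least 1 by integrality, and at most a fraction
  \<open>t\<close> of the distance to the maximum by monotonicity and linearity.\<close>

lemma mixed_volume_gap_wellorder:
  fixes A B :: "'n::{finite,wellorder} \<Rightarrow> (real^'n::_) set"
  assumes fin: "\<And>i. finite (A i)" "\<And>i. finite (B i)" "finite Q"
    and ints: "\<And>i v j. v \<in> A i \<Longrightarrow> v $ j \<in> \<int>" "\<And>i v j. v \<in> B i \<Longrightarrow> v $ j \<in> \<int>"
    and interior: "\<And>i. interior (convex hull A i) \<noteq> {}"
    and AB: "\<And>i. A i \<subseteq> B i" "\<And>i. i \<noteq> m \<Longrightarrow> B i = A i"
    and AQ: "\<And>i. A i \<subseteq> convex hull Q"
    and st: "0 < s" "0 < t" "s + t = 1"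
    and Bm: "B m \<subseteq> (*\<^sub>R) s ` (convex hull A m) + (*\<^sub>R) t ` (convex hull Q)"
    and less: "mixed_volume (\<lambda>i. convex hull A i) < mixed_volume (\<lambda>i. convex hull B i)"
  shows "1 \<le> t * (mixed_volume (\<lambda>_::'n. convex hull Q) - mixed_volume (\<lambda>i. convex hull A i))"
proof -
  let ?P = "\<lambda>i. convex hull A i"
  define S where "S = (*\<^sub>R) s ` A m + (*\<^sub>R) t ` Q"
  have intB: "interior (convex hull B i) \<noteq> {}" for i
    using interior[of i] interior_mono[OF hull_mono[OF AB(1)[of i]], of convex] by blast
  have AQ': "convex hull A i \<subseteq> convex hull Q" for i
    by (rule hull_minimal[OF AQ]) simp
  have intQ: "interior (convex hull Q) \<noteq> {}"
    using interior[of m] interior_mono[OF AQ'[of m]] by blast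
  have "finite S"
    unfolding S_def using fin by (simp add: finite_set_plus)
  have hullS: "convex hull S = (*\<^sub>R) s ` (convex hull A m) + (*\<^sub>R) t ` (convex hull Q)"
    by (simp add: S_def convex_hull_set_plus convex_hull_scaling)
  have "mixed_volume (\<lambda>i. convex hull B i) \<le> mixed_volume (\<lambda>i. convex hull (if i = m then S else A i))"
  proof (rule mixed_volume_mono)
    have "convex hull B m \<subseteq> convex hull S"
      using Bm unfolding hullS[symmetric] by (rule hull_minimal) simp
    then show "convex hull B i \<subseteq> convex hull (if i = m then S else A i)" for i
      using AB(2)[of i] by auto
  qed (use fin \<open>finite S\<close> intB in auto)
  also have "(\<lambda>i. convex hull (if i = m then S else A i)) = ?P(m := convex hull S)"
    by (simp add: fun_eq_iff)
  also have "mixed_volume (?P(m := convex hull S)) = s * mixed_volume ?P + t * mixed_volume (?P(m := convex hull Q))"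
    unfolding hullS using fin interior intQ st by (intro mixed_volume_linear) auto
  also have "mixed_volume (?P(m := convex hull Q)) \<le> mixed_volume (\<lambda>_. convex hull Q)"
  proof -
    have "?P(m := convex hull Q) = (\<lambda>i. convex hull (if i = m then Q else A i))"
      by (simp add: fun_eq_iff)
    moreover have "mixed_volume (\<lambda>i. convex hull (if i = m then Q else A i)) \<le> mixed_volume (\<lambda>_. convex hull Q)"
      using fin interior intQ AQ' by (intro mixed_volume_mono) auto
    ultimately show ?thesis by simp
  qed
  finally have "mixed_volume (\<lambda>i. convex hull B i) \<le> s * mixed_volume ?P + t * mixed_volume (\<lambda>_. convex hull Q)"
    using st by simp
  moreover have "mixed_volume ?P + 1 \<le> mixed_volume (\<lambda>i. convex hull B i)"
  proof -
    have "mixed_volume ?P \<in> \<int>"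
      by (rule mixed_volume_Ints[of A, OF fin(1) interior ints(1)])
    then obtain p where p: "mixed_volume ?P = of_int p"
      by (rule Ints_cases)
    have "mixed_volume (\<lambda>i. convex hull B i) \<in> \<int>"
      by (rule mixed_volume_Ints[of B, OF fin(2) intB ints(2)])
    then obtain q where "mixed_volume (\<lambda>i. convex hull B i) = of_int q"
      by (rule Ints_cases)
    then show ?thesis
      using less p by simp
  qed
  moreover have "s = 1 - t"
    using st by simp
  ultimately show ?thesis
    by (simp add: algebra_simps)
qed

text \<open>The change of variables theorem of HOL-Analysis needs a well-ordered index type. The statement
  just proved does not mention the order, so it transfers to any finite index type.\<close>

typedef 'a enumerated = "UNIV :: 'a set" ..

instance enumerated :: (finite) finite
proof
  have "inj (Rep_enumerated :: 'a enumerated \<Rightarrow> 'a)"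
    by (meson Rep_enumerated_inject injI)
  then show "finite (UNIV :: 'a enumerated set)"
    by (rule finite_imageD[rotated]) simp
qed

instantiation enumerated :: (finite) wellorder
begin

definition less_eq_enumerated :: "'a enumerated \<Rightarrow> 'a enumerated \<Rightarrow> bool" where
  "x \<le> y \<longleftrightarrow> to_nat (Rep_enumerated x) \<le> to_nat (Rep_enumerated y)"

definition less_enumerated :: "'a enumerated \<Rightarrow> 'a enumerated \<Rightarrow> bool" where
  "x < y \<longleftrightarrow> to_nat (Rep_enumerated x) < to_nat (Rep_enumerated y)"

instance
proof
  fix x y z :: "'a enumerated"
  show "x < y \<longleftrightarrow> x \<le> y \<and> \<not> y \<le> x" "x \<le> x" "x \<le> y \<or> y \<le> x"
    unfolding less_eq_enumerated_def less_enumerated_def by linarith+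
  show "x \<le> z" if "x \<le> y" "y \<le> z"
    using that unfolding less_eq_enumerated_def by linarith
  show "x = y" if "x \<le> y" "y \<le> x"
    using that unfolding less_eq_enumerated_def by (simp add: Rep_enumerated_inject)
  show "P x" if step: "\<And>x. (\<And>y. y < x \<Longrightarrow> P y) \<Longrightarrow> P x" for P
  proof (rule measure_induct_rule[where f="\<lambda>x. to_nat (Rep_enumerated x)"])
    fix x :: "'a enumerated"
    assume "\<And>y. to_nat (Rep_enumerated y) < to_nat (Rep_enumerated x) \<Longrightarrow> P y"
    then show "P x"
      by (rule step) (simp only: less_enumerated_def)
  qed
qed

end

section \<open>Renaming coordinates preserves Lebesgue measure and mixed volumes\<close>

lemma bij_Rep_enumerated: "bij Rep_enumerated"
  by (metis Abs_enumerated_inverse Rep_enumerated_inverse UNIV_I bijI')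

lemma range_Rep_enumerated: "range Rep_enumerated = UNIV"
  by (rule bij_is_surj[OF bij_Rep_enumerated])

definition reindex :: "real^'n::finite \<Rightarrow> real^'n enumerated" where
  "reindex x = (\<chi> i. x $ Rep_enumerated i)"

definition unreindex :: "real^'n::finite enumerated \<Rightarrow> real^'n" where
  "unreindex y = (\<chi> i. y $ Abs_enumerated i)"

lemma reindex_inverse [simp]: "unreindex (reindex x) = x" "reindex (unreindex y) = y"
  by (simp_all add: reindex_def unreindex_def Abs_enumerated_inverse Rep_enumerated_inverse)

lemma linear_reindex: "linear reindex"
  by (rule linearI) (simp_all add: reindex_def vec_eq_iff)

lemma bij_reindex: "bij reindex"
  by (rule o_bij[of unreindex]) auto

text \<open>Renaming coordinates permutes the edge lengths of a box, and Lebesgue measure is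
  determined by its values on boxes.\<close>

lemma lborel_reindex: "distr lborel borel (reindex :: real^'n::finite \<Rightarrow> _) = lborel"
proof (rule lborel_eqI[symmetric])
  have cont: "continuous_on UNIV (reindex :: real^'n \<Rightarrow> _)"
    by (simp add: linear_continuous_on linear_linear linear_reindex)
  then have meas: "(reindex :: real^'n \<Rightarrow> _) \<in> borel_measurable borel"
    by (rule borel_measurable_continuous_onI)
  fix l u :: "real^'n enumerated"
  assume lu: "\<And>b. b \<in> Basis \<Longrightarrow> l \<bullet> b \<le> u \<bullet> b"
  have le: "l $ i \<le> u $ i" for i
    using lu[of "axis i 1"] by (simp add: inner_axis)
  have prod_Basis: "(\<Prod>b\<in>Basis. (y - x) \<bullet> b) = (\<Prod>i\<in>UNIV. y $ i - x $ i)" for x y :: "real^'m::finite"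
  proof -
    have inj: "inj (\<lambda>i::'m. axis i (1::real))"
      by (simp add: inj_def axis_eq_axis)
    have Basis: "(Basis :: (real^'m) set) = range (\<lambda>i. axis i 1)"
      by (auto simp: Basis_vec_def)
    show ?thesis
      unfolding Basis prod.reindex[OF inj] by (simp add: inner_axis)
  qed
  have "reindex -` box l u = box (unreindex l) (unreindex u)"
    by (auto simp: mem_box_cart reindex_def unreindex_def)
      (metis Abs_enumerated_inverse Rep_enumerated_inverse UNIV_I)+
  then have "emeasure (distr lborel borel reindex) (box l u) = emeasure lborel (box (unreindex l) (unreindex u))"
    using meas by (simp add: emeasure_distr)
  also have "\<dots> = (\<Prod>b\<in>Basis. (unreindex u - unreindex l) \<bullet> b)"
    using le by (intro emeasure_lborel_box) (auto simp: Basis_vec_def inner_axis unreindex_def)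
  also have "(\<Prod>b\<in>Basis. (unreindex u - unreindex l) \<bullet> b) = (\<Prod>i\<in>UNIV. u $ i - l $ i)"
    unfolding prod_Basis unreindex_def
    by (simp, rule prod.reindex_bij_witness[where i=Rep_enumerated and j=Abs_enumerated])
      (auto simp: Abs_enumerated_inverse Rep_enumerated_inverse)
  finally show "emeasure (distr lborel borel (reindex :: real^'n \<Rightarrow> _)) (box l u) = ennreal (\<Prod>b\<in>Basis. (u - l) \<bullet> b)"
    unfolding prod_Basis .
qed simp

lemma measure_reindex:
  fixes S :: "(real^'n::finite) set"
  assumes "compact S"
  shows "measure lebesgue (reindex ` S) = measure lebesgue S"
proof -
  have cont: "continuous_on X (reindex :: real^'n \<Rightarrow> _)" for X
    by (simp add: linear_continuous_on linear_linear linear_reindex)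
  then have meas: "(reindex :: real^'n \<Rightarrow> _) \<in> borel_measurable borel"
    by (intro borel_measurable_continuous_onI)
  have S: "S \<in> sets borel" "reindex ` S \<in> sets borel"
    using assms compact_continuous_image[OF cont assms] by (auto intro: borel_compact)
  have "measure lborel (reindex ` S) = measure (distr lborel borel reindex) (reindex ` S)"
    by (simp add: lborel_reindex)
  also have "\<dots> = measure lborel (reindex -` reindex ` S)"
    using S meas by (simp add: measure_distr)
  also have "reindex -` reindex ` S = S"
    by (rule inj_vimage_image_eq[OF bij_is_inj[OF bij_reindex]])
  finally show ?thesis
    using S by (simp add: measure_completion)
qed

lemma mixed_volume_reindex:
  fixes A :: "'n::finite \<Rightarrow> (real^'n) set"
  assumes "\<And>i. finite (A i)"
  shows "mixed_volume (\<lambda>i. convex hull (reindex ` A (Rep_enumerated i))) = mixed_volume (\<lambda>i. convex hull A i)"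
proof -
  have card: "CARD('n enumerated) = CARD('n)"
    using bij_betw_same_card[OF bij_Rep_enumerated] .
  have inj: "inj_on Rep_enumerated I" for I :: "'n enumerated set"
    using bij_Rep_enumerated by (meson bij_def inj_on_subset subset_UNIV)
  have sum_eq: "(\<Sum>i\<in>I. convex hull (reindex ` A (Rep_enumerated i))) =
      reindex ` (\<Sum>j\<in>Rep_enumerated ` I. convex hull A j)" for I :: "'n enumerated set"
  proof -
    have "reindex ` (\<Sum>j\<in>Rep_enumerated ` I. convex hull A j) = (\<Sum>j\<in>Rep_enumerated ` I. reindex ` (convex hull A j))"
    proof (subst sum_set_linear)
      show "reindex ` X + reindex ` Y = reindex ` (X + Y)" for X Y :: "(real^'n) set"
        by (force simp: set_plus_def linear_add[OF linear_reindex])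
    qed (auto simp: linear_0[OF linear_reindex])
    then show ?thesis
      by (simp add: sum.reindex[OF inj] convex_hull_linear_image[OF linear_reindex])
  qed
  have comp: "compact (\<Sum>j\<in>J. convex hull A j)" for J
    unfolding convex_hull_set_sum[symmetric]
    by (rule finite_imp_compact_convex_hull) (use assms in \<open>auto intro: finite_set_sum\<close>)
  have "mixed_volume (\<lambda>i. convex hull (reindex ` A (Rep_enumerated i))) =
     (\<Sum>I\<in>UNIV. (-1) ^ (CARD('n) - card (Rep_enumerated ` I)) * measure lebesgue (\<Sum>j\<in>Rep_enumerated ` I. convex hull A j))"
    unfolding mixed_volume_def sum_eq measure_reindex[OF comp] card card_image[OF inj] ..
  also have "\<dots> = mixed_volume (\<lambda>i. convex hull A i)"
    unfolding mixed_volume_def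
    by (rule sum.reindex_bij_witness[where i="\<lambda>J. Rep_enumerated -` J" and j="\<lambda>I. Rep_enumerated ` I"])
      (simp_all add: range_Rep_enumerated inj_vimage_image_eq[OF bij_is_inj[OF bij_Rep_enumerated]]
        surj_image_vimage_eq[OF bij_is_surj[OF bij_Rep_enumerated]])
  finally show ?thesis .
qed

lemma mixed_volume_gap:
  fixes A B :: "'n::finite \<Rightarrow> (real^'n) set"
  assumes fin: "\<And>i. finite (A i)" "\<And>i. finite (B i)" "finite Q"
    and ints: "\<And>i v j. v \<in> A i \<Longrightarrow> v $ j \<in> \<int>" "\<And>i v j. v \<in> B i \<Longrightarrow> v $ j \<in> \<int>"
    and interior: "\<And>i. interior (convex hull A i) \<noteq> {}"
    and AB: "\<And>i. A i \<subseteq> B i" "\<And>i. i \<noteq> m \<Longrightarrow> B i = A i"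
    and AQ: "\<And>i. A i \<subseteq> convex hull Q"
    and st: "0 < s" "0 < t" "s + t = 1"
    and Bm: "B m \<subseteq> (*\<^sub>R) s ` (convex hull A m) + (*\<^sub>R) t ` (convex hull Q)"
    and less: "mixed_volume (\<lambda>i. convex hull A i) < mixed_volume (\<lambda>i. convex hull B i)"
  shows "1 \<le> t * (mixed_volume (\<lambda>_::'n. convex hull Q) - mixed_volume (\<lambda>i. convex hull A i))"
proof -
  let ?A = "\<lambda>i. reindex ` A (Rep_enumerated i)" and ?B = "\<lambda>i. reindex ` B (Rep_enumerated i)"
  have hull: "convex hull (reindex ` X) = reindex ` (convex hull X)" for X :: "(real^'n) set"
    by (simp add: convex_hull_linear_image[OF linear_reindex])
  have "1 \<le> t * (mixed_volume (\<lambda>_::'n enumerated. convex hull (reindex ` Q)) - mixed_volume (\<lambda>i. convex hull ?A i))"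
  proof (rule mixed_volume_gap_wellorder[where B = ?B and m = "Abs_enumerated m" and s = s])
    show "interior (convex hull ?A i) \<noteq> {}" for i
    proof -
      let ?U = "interior (convex hull A (Rep_enumerated i))"
      have "surj (reindex :: real^'n \<Rightarrow> _)"
        using bij_reindex by (rule bij_is_surj)
      then have "open (reindex ` ?U)"
        using linear_reindex by (intro open_surjective_linear_image) auto
      moreover have "reindex ` ?U \<subseteq> convex hull ?A i"
        unfolding hull by (intro image_mono interior_subset)
      ultimately have "reindex ` ?U \<subseteq> interior (convex hull ?A i)"
        by (intro interior_maximal)
      then show ?thesis
        using interior by blast
    qed
    show "?B (Abs_enumerated m) \<subseteq> (*\<^sub>R) s ` (convex hull ?A (Abs_enumerated m)) + (*\<^sub>R) t ` (convex hull (reindex ` Q))"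
    proof
      fix w assume "w \<in> ?B (Abs_enumerated m)"
      then obtain v where v: "v \<in> B m" "w = reindex v"
        by (auto simp: Abs_enumerated_inverse)
      then obtain p q where "p \<in> convex hull A m" "q \<in> convex hull Q" "v = s *\<^sub>R p + t *\<^sub>R q"
        using Bm by (auto simp: set_plus_def)
      then show "w \<in> (*\<^sub>R) s ` (convex hull ?A (Abs_enumerated m)) + (*\<^sub>R) t ` (convex hull (reindex ` Q))"
        unfolding hull Abs_enumerated_inverse[OF UNIV_I] v(2)
        by (auto simp: linear_add[OF linear_reindex] linear_cmul[OF linear_reindex] intro!: set_plus_intro)
    qed
    show "?B i = ?A i" if "i \<noteq> Abs_enumerated m" for i
      using that AB(2)[of "Rep_enumerated i"] by (metis Rep_enumerated_inverse)
    show "mixed_volume (\<lambda>i. convex hull ?A i) < mixed_volume (\<lambda>i. convex hull ?B i)"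
      unfolding mixed_volume_reindex[of A, OF fin(1)] mixed_volume_reindex[of B, OF fin(2)] by (rule less)
    show "?A i \<subseteq> ?B i" "?A i \<subseteq> convex hull (reindex ` Q)" for i
      unfolding hull by (rule image_mono[OF AB(1)], rule image_mono[OF AQ])
    show "v $ j \<in> \<int>" if "v \<in> ?A i" for i v j
      using that ints(1) by (auto simp: reindex_def)
    show "v $ j \<in> \<int>" if "v \<in> ?B i" for i v j
      using that ints(2) by (auto simp: reindex_def)
  qed (simp_all add: fin st)
  then show ?thesis
    unfolding mixed_volume_reindex[of A, OF fin(1)] mixed_volume_reindex[of "\<lambda>_. Q", OF fin(3)] .
qed

subsection \<open>Truncation in the positive orthant\<close>

definition coord_sum :: "real^'n::finite \<Rightarrow> real" where
  "coord_sum x = (\<Sum>i\<in>UNIV. x $ i)"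

definition truncate :: "real \<Rightarrow> (real^'n::finite) set \<Rightarrow> (real^'n) set" where
  "truncate r X = {x \<in> X. coord_sum x \<le> r}"

text \<open>Replaces boundedness of the complement by a threshold in \<open>coord_sum\<close>.
  Positive thresholds add under Minkowski sums, which is what makes cutting compatible with
  them.\<close>

definition cofinal_from :: "real \<Rightarrow> (real^'n::finite) set \<Rightarrow> bool" where
  "cofinal_from r X \<longleftrightarrow> X \<subseteq> positive_orthant \<and> convex X \<and> {x \<in> positive_orthant. r \<le> coord_sum x} \<subseteq> X"

lemma coord_sum_simps [simp]:
  "coord_sum (x + y) = coord_sum x + coord_sum y" "coord_sum (c *\<^sub>R x) = c * coord_sum x"
  "coord_sum (x - y) = coord_sum x - coord_sum y" "coord_sum 0 = 0" "coord_sum (axis i r) = r"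
  by (simp_all add: coord_sum_def sum.distrib sum_subtractf sum_distrib_left axis_def)

lemma positive_orthant_intros [intro!]:
  "x \<in> positive_orthant \<Longrightarrow> y \<in> positive_orthant \<Longrightarrow> x + y \<in> positive_orthant"
  "0 \<le> c \<Longrightarrow> x \<in> positive_orthant \<Longrightarrow> c *\<^sub>R x \<in> positive_orthant"
  "0 \<in> positive_orthant" "0 \<le> r \<Longrightarrow> axis i r \<in> positive_orthant"
  by (auto simp: positive_orthant_def axis_def)

lemma convex_positive_orthant: "convex positive_orthant"
  by (auto intro!: convexI)

lemma coord_sum_nonneg: "x \<in> positive_orthant \<Longrightarrow> 0 \<le> coord_sum x"
  by (auto simp: positive_orthant_def coord_sum_def intro: sum_nonneg)

lemma coord_sum_eq_0: "x \<in> positive_orthant \<Longrightarrow> coord_sum x = 0 \<Longrightarrow> x = 0"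
  by (auto simp: positive_orthant_def coord_sum_def sum_nonneg_eq_0_iff vec_eq_iff)

lemma continuous_on_coord_sum [continuous_intros]: "continuous_on S coord_sum"
  unfolding coord_sum_def by (intro continuous_intros)

lemma convex_truncate: "convex X \<Longrightarrow> convex (truncate r X)"
proof -
  have "truncate r X = X \<inter> {x. (\<chi> i. 1) \<bullet> x \<le> r}"
    by (auto simp: truncate_def coord_sum_def inner_vec_def)
  then show "convex X \<Longrightarrow> convex (truncate r X)"
    by (simp add: convex_Int convex_halfspace_le)
qed

lemma polyhedron_truncate: "polyhedron X \<Longrightarrow> polyhedron (truncate r X)"
proof -
  have "truncate r X = X \<inter> {x. (\<chi> i. 1) \<bullet> x \<le> r}"
    by (auto simp: truncate_def coord_sum_def inner_vec_def)
  then show "polyhedron X \<Longrightarrow> polyhedron (truncate r X)"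
    by (simp add: polyhedron_halfspace_le)
qed

lemma bounded_truncate:
  assumes "X \<subseteq> positive_orthant"
  shows "bounded (truncate r X)"
proof (rule boundedI)
  fix x assume "x \<in> truncate r X"
  then have x: "\<And>i. 0 \<le> x $ i" "coord_sum x \<le> r"
    using assms by (auto simp: truncate_def positive_orthant_def)
  have "norm x \<le> (\<Sum>i\<in>UNIV. \<bar>x $ i\<bar>)"
    by (rule norm_le_l1_cart)
  then show "norm x \<le> r"
    using x by (simp add: coord_sum_def)
qed

lemma cofinal_from_positive_orthant: "cofinal_from r positive_orthant"
  by (auto simp: cofinal_from_def convex_positive_orthant)

lemma cofinal_from_memI: "cofinal_from r X \<Longrightarrow> x \<in> positive_orthant \<Longrightarrow> r \<le> coord_sum x \<Longrightarrow> x \<in> X"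
  by (auto simp: cofinal_from_def)

lemma cofinal_from_mono: "cofinal_from r X \<Longrightarrow> r \<le> r' \<Longrightarrow> cofinal_from r' X"
  by (auto simp: cofinal_from_def)

text \<open>Far enough out in direction \<open>c\<close> the ray from \<open>x\<close> is above the
  threshold and thus in \<open>X\<close>; convexity brings \<open>x + c\<close> back. The factor
  \<open>K\<close> is chosen at least 1 so that \<open>x + c\<close> lies on that segment.\<close>

lemma cofinal_from_add:
  assumes X: "cofinal_from r X" and x: "x \<in> X" and c: "c \<in> positive_orthant"
  shows "x + c \<in> X"
proof (cases "c = 0")
  case False
  then have pos: "0 < coord_sum c"
    using c coord_sum_nonneg[of c] coord_sum_eq_0[of c] by force
  have x': "x \<in> positive_orthant"
    using X x by (auto simp: cofinal_from_def)
  define K where "K = max 1 (r / coord_sum c)"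
  have K: "1 \<le> K" "0 \<le> K" "r \<le> K * coord_sum c"
    using pos by (auto simp: K_def pos_divide_le_eq[symmetric])
  have "x + K *\<^sub>R c \<in> X"
    using x' c K coord_sum_nonneg[OF x'] by (auto intro!: cofinal_from_memI[OF X])
  then have "(1 - 1 / K) *\<^sub>R x + (1 / K) *\<^sub>R (x + K *\<^sub>R c) \<in> X"
    using X x K by (intro convexD) (auto simp: cofinal_from_def)
  moreover have "(1 - 1 / K) *\<^sub>R x + (1 / K) *\<^sub>R (x + K *\<^sub>R c) = x + c"
    using K by (simp add: algebra_simps)
  ultimately show ?thesis by simp
qed (use x in simp)

text \<open>A point of the cut sum may decompose with one summand above its own level. The surplus
  of that summand is moved to the other one, which stays in its set by upward closure.\<close>

lemma truncate_set_plus: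
  fixes X Y :: "(real^'n::finite) set"
  assumes X: "cofinal_from a X" and Y: "cofinal_from b Y" and ab: "0 < a" "0 < b"
  shows "cofinal_from (a + b) (X + Y)" "truncate (a + b) (X + Y) = truncate a X + truncate b Y"
proof -
  show "cofinal_from (a + b) (X + Y)"
    unfolding cofinal_from_def
  proof (intro conjI subsetI)
    show "convex (X + Y)"
      using X Y by (auto simp: cofinal_from_def intro: convex_set_plus)
    show "z \<in> positive_orthant" if "z \<in> X + Y" for z
      using that X Y by (auto simp: cofinal_from_def set_plus_def)
    fix z :: "real^'n" assume "z \<in> {x \<in> positive_orthant. a + b \<le> coord_sum x}"
    then have z: "z \<in> positive_orthant" "a + b \<le> coord_sum z"
      by auto
    \<comment> \<open>Dividing \<open>z\<close> in the proportion of the thresholds leaves each part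
      above its own threshold.\<close>
    have part: "(c / (a + b)) *\<^sub>R z \<in> W" if "cofinal_from c W" "0 < c" for c W
    proof (rule cofinal_from_memI[OF that(1)])
      show "(c / (a + b)) *\<^sub>R z \<in> positive_orthant"
        using z that ab by (intro positive_orthant_intros) auto
      have "c / (a + b) * (a + b) \<le> c / (a + b) * coord_sum z"
        using z that ab by (intro mult_left_mono) auto
      then show "c \<le> coord_sum ((c / (a + b)) *\<^sub>R z)"
        using ab by simp
    qed
    have "(a / (a + b)) *\<^sub>R z \<in> X" "(b / (a + b)) *\<^sub>R z \<in> Y"
      using part X Y ab by auto
    moreover have "z = (a / (a + b)) *\<^sub>R z + (b / (a + b)) *\<^sub>R z"
      using ab by (simp flip: scaleR_add_left add_divide_distrib)
    ultimately show "z \<in> X + Y"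
      using set_plus_intro[of "(a / (a + b)) *\<^sub>R z" X "(b / (a + b)) *\<^sub>R z" Y] by simp
  qed
  have split: "x + y \<in> truncate a X + truncate b Y"
    if X: "cofinal_from a X" and Y: "cofinal_from b Y" and x: "x \<in> X" and y: "y \<in> Y"
      and s: "coord_sum (x + y) \<le> a + b" "a < coord_sum x" and "0 < a" for a b and X Y :: "(real^'n) set" and x y
  proof -
    \<comment> \<open>Scales \<open>x\<close> down to level exactly \<open>a\<close>, which is still
      in \<open>X\<close>.\<close>
    define \<theta> where "\<theta> = a / coord_sum x"
    have \<theta>: "0 < \<theta>" "\<theta> < 1" "\<theta> * coord_sum x = a"
      using s \<open>0 < a\<close> by (auto simp: \<theta>_def)
    have x': "x \<in> positive_orthant"
      using X x by (auto simp: cofinal_from_def)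
    have "\<theta> *\<^sub>R x \<in> truncate a X"
      using x' \<theta> by (auto simp: truncate_def intro!: cofinal_from_memI[OF X])
    moreover have "y + (1 - \<theta>) *\<^sub>R x \<in> truncate b Y"
    proof -
      have "y + (1 - \<theta>) *\<^sub>R x \<in> Y"
        by (rule cofinal_from_add[OF Y y]) (use x' \<theta> in auto)
      moreover have "coord_sum (y + (1 - \<theta>) *\<^sub>R x) = coord_sum (x + y) - a"
        unfolding \<theta>(3)[symmetric] by (simp add: algebra_simps)
      ultimately show ?thesis
        using s by (simp add: truncate_def)
    qed
    moreover have "x + y = \<theta> *\<^sub>R x + (y + (1 - \<theta>) *\<^sub>R x)"
      by (simp add: algebra_simps)
    ultimately show ?thesis
      by (simp only: set_plus_intro)
  qed
  show "truncate (a + b) (X + Y) = truncate a X + truncate b Y"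
  proof (intro antisym subsetI)
    fix z assume "z \<in> truncate (a + b) (X + Y)"
    then obtain x y where xy: "x \<in> X" "y \<in> Y" "z = x + y" "coord_sum (x + y) \<le> a + b"
      by (auto simp: truncate_def set_plus_def)
    consider "a < coord_sum x" | "b < coord_sum y" | "coord_sum x \<le> a" "coord_sum y \<le> b"
      by linarith
    then show "z \<in> truncate a X + truncate b Y"
    proof cases
      case 1
      then show ?thesis
        using split[OF X Y xy(1,2,4) 1 ab(1)] xy by simp
    next
      case 2
      then show ?thesis
        using split[OF Y X xy(2,1) _ 2 ab(2)] xy by (simp add: add.commute)
    qed (use xy in \<open>auto simp: truncate_def\<close>)
  qed (auto simp: truncate_def set_plus_def)
qed

lemma truncate_set_sum:
  assumes "finite I" "I \<noteq> {}" "\<And>i. i \<in> I \<Longrightarrow> cofinal_from r (X i)" "0 < r"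
  shows "cofinal_from (real (card I) * r) (\<Sum>i\<in>I. X i) \<and>
    truncate (real (card I) * r) (\<Sum>i\<in>I. X i) = (\<Sum>i\<in>I. truncate r (X i))"
  using assms(1-3)
proof (induction I rule: finite_ne_induct)
  case (insert j I)
  then have IH: "cofinal_from (real (card I) * r) (\<Sum>i\<in>I. X i)"
    "truncate (real (card I) * r) (\<Sum>i\<in>I. X i) = (\<Sum>i\<in>I. truncate r (X i))"
    by auto
  have "0 < real (card I) * r"
    using insert \<open>0 < r\<close> by (simp add: card_gt_0_iff)
  note plus = truncate_set_plus[OF _ IH(1) \<open>0 < r\<close> this, of "X j"]
  have "real (card (insert j I)) * r = r + real (card I) * r"
    using insert by (simp add: algebra_simps)
  then show ?case
    using plus insert IH by simp
qed simp

text \<open>Above level \<open>card I * r\<close> the sum of the \<open>B i\<close> fills the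
  orthant, so its complement is a difference of truncations, and these are the Minkowski sums of the
  truncations at level \<open>r\<close>. For empty \<open>I\<close> both sides are 0.\<close>

lemma rel_mixed_volume_eq_mixed_volume_diff:
  fixes B :: "'n::finite \<Rightarrow> (real^'n) set"
  assumes B: "\<And>i. cofinal_from r (B i)" and r: "0 < r"
  shows "rel_mixed_volume positive_orthant B =
    mixed_volume (\<lambda>_::'n. truncate r positive_orthant) - mixed_volume (\<lambda>i. truncate r (B i))"
proof -
  let ?C = "positive_orthant :: (real^'n) set"
  have "rel_volume ?C (rel_minkowski_sum ?C B I) / fact CARD('n) =
      measure lebesgue (\<Sum>i\<in>I. truncate r ?C) - measure lebesgue (\<Sum>i\<in>I. truncate r (B i))" for I
  proof (cases "I = {}")
    case False
    let ?R = "real (card I) * r" and ?S = "\<Sum>i\<in>I. B i"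
    have S: "cofinal_from ?R ?S" "truncate ?R ?S = (\<Sum>i\<in>I. truncate r (B i))"
      using truncate_set_sum[of I r B] False B r by auto
    have "(\<Sum>i\<in>I. ?C) = ?C"
      using False card_gt_0_iff[of I] scaleR_positive_orthant[of "real (card I)"]
      by (simp add: sum_constant_convex convex_positive_orthant)
    then have C: "truncate ?R ?C = (\<Sum>i\<in>I. truncate r ?C)"
      using truncate_set_sum[of I r "\<lambda>_. ?C"] False cofinal_from_positive_orthant r by auto
    have sub: "?S \<subseteq> ?C" "convex ?S" and large: "x \<in> ?C \<Longrightarrow> ?R \<le> coord_sum x \<Longrightarrow> x \<in> ?S" for x
      using S(1) by (auto simp: cofinal_from_def)
    have "?C - ?S = truncate ?R ?C - truncate ?R ?S"
      using large by (auto simp: truncate_def) (meson linear)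
    moreover have "truncate ?R ?C \<in> lmeasurable" "truncate ?R ?S \<in> lmeasurable"
      using sub by (auto intro!: measurable_convex convex_truncate bounded_truncate convex_positive_orthant)
    moreover have "truncate ?R ?S \<subseteq> truncate ?R ?C"
      using sub by (auto simp: truncate_def)
    ultimately have "measure lebesgue (?C - ?S) = measure lebesgue (truncate ?R ?C) - measure lebesgue (truncate ?R ?S)"
      by (simp add: measurable_measure_Diff fmeasurableD)
    then show ?thesis
      using False by (simp add: rel_volume_def rel_minkowski_sum_def C S(2))
  qed (simp add: rel_volume_def rel_minkowski_sum_def)
  then show ?thesis
    unfolding rel_mixed_volume_def mixed_volume_def
    by (simp add: sum_divide_distrib right_diff_distrib sum_subtractf flip: times_divide_eq_right)
qed

section \<open>The cutting simplex, and vertices of cut polyhedra\<close>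

lemma facet_in_hull:
  assumes "x \<in> positive_orthant" "coord_sum x = r" "0 < r"
  shows "x \<in> convex hull (range (\<lambda>i. axis i r))"
proof -
  have "(\<Sum>i\<in>UNIV. (x $ i / r) *\<^sub>R axis i r) \<in> convex hull (range (\<lambda>i. axis i r))"
    using assms
    by (intro convex_sum) (auto simp: positive_orthant_def coord_sum_def hull_inc simp flip: sum_divide_distrib)
  moreover have "(\<Sum>i\<in>UNIV. (x $ i / r) *\<^sub>R axis i r) = x"
    using assms(3) by (simp add: vec_eq_iff axis_def if_distrib cong: if_cong)
  ultimately show ?thesis by simp
qed

lemma hull_simplex:
  assumes "0 < r"
  shows "convex hull (insert 0 (range (\<lambda>i. axis i r))) = truncate r (positive_orthant :: (real^'n::finite) set)"
proof (intro antisym hull_minimal subsetI)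
  fix x :: "real^'n" assume "x \<in> truncate r positive_orthant"
  then have x: "x \<in> positive_orthant" "coord_sum x \<le> r"
    by (auto simp: truncate_def)
  show "x \<in> convex hull (insert 0 (range (\<lambda>i. axis i r)))"
  proof (cases "x = 0")
    case False
    then have pos: "0 < coord_sum x"
      using x coord_sum_nonneg[of x] coord_sum_eq_0[of x] by force
    define \<theta> where "\<theta> = coord_sum x / r"
    have "(1 / \<theta>) *\<^sub>R x \<in> convex hull (range (\<lambda>i. axis i r))"
      using pos x assms by (intro facet_in_hull) (auto simp: \<theta>_def)
    then have "(1 / \<theta>) *\<^sub>R x \<in> convex hull (insert 0 (range (\<lambda>i. axis i r)))"
      by (rule subsetD[OF hull_mono, rotated]) auto
    then have "\<theta> *\<^sub>R (1 / \<theta>) *\<^sub>R x + (1 - \<theta>) *\<^sub>R 0 \<in> convex hull (insert 0 (range (\<lambda>i. axis i r)))"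
      using pos x assms by (intro convexD convex_convex_hull) (auto simp: \<theta>_def hull_inc)
    then show ?thesis
      using pos assms by (simp add: \<theta>_def)
  qed (simp add: hull_inc)
next
  show "convex (truncate r (positive_orthant :: (real^'n) set))"
    by (intro convex_truncate convex_positive_orthant)
qed (use assms in \<open>auto simp: truncate_def\<close>)

text \<open>A vertex on the cutting hyperplane lies in a facet which is a simplex with vertices
  \<open>axis i M\<close>, integral since \<open>M\<close> is a natural number. A vertex strictly
  below it is already a vertex of \<open>B\<close>, because extremality is a local property.\<close>

lemma extreme_points_truncate:
  fixes B :: "(real^'n::finite) set"
  assumes B: "cofinal_from r B" "lattice_polyhedron B" and r: "r \<le> real M" "0 < M"
  defines "A \<equiv> {x. x extreme_point_of truncate M B}"
  shows "finite A" "convex hull A = truncate M B" "\<And>v j. v \<in> A \<Longrightarrow> v $ j \<in> \<int>"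
proof -
  have sub: "B \<subseteq> positive_orthant" "convex B" and large: "\<And>x. x \<in> positive_orthant \<Longrightarrow> r \<le> coord_sum x \<Longrightarrow> x \<in> B"
    using B by (auto simp: cofinal_from_def)
  have poly: "polyhedron (truncate M B)"
    using B by (auto simp: lattice_polyhedron_def intro: polyhedron_truncate)
  then show "finite A"
    unfolding A_def by (rule finite_polyhedron_extreme_points)
  have "compact (truncate M B)"
    using poly sub by (simp add: compact_eq_bounded_closed bounded_truncate polyhedron_imp_closed)
  then show "convex hull A = truncate M B"
    unfolding A_def using Krein_Milman_Minkowski convex_truncate sub by metis
  fix v j assume "v \<in> A"
  then have v: "v extreme_point_of truncate M B"
    by (simp add: A_def)
  then have vB: "v \<in> B" "coord_sum v \<le> M"
    by (auto simp: extreme_point_of_def truncate_def)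
  show "v $ j \<in> \<int>"
  proof (cases "coord_sum v = M")
    case True
    let ?F = "range (\<lambda>i. axis i (real M)) :: (real^'n) set"
    have "?F \<subseteq> truncate M B"
      using r by (auto simp: truncate_def intro!: large)
    then have F: "convex hull ?F \<subseteq> truncate M B"
      by (intro hull_minimal convex_truncate sub)
    have "v \<in> convex hull ?F"
      using vB sub True r by (intro facet_in_hull) auto
    then have "v extreme_point_of (convex hull ?F)"
      using v F by (auto simp: extreme_point_of_def)
    then have "v \<in> ?F"
      by (rule extreme_point_of_convex_hull)
    then show ?thesis
      by (auto simp: axis_def)
  next
    case False
    have "v extreme_point_of B"
      unfolding extreme_point_of_def
    proof (intro conjI ballI notI)
      fix a b assume ab: "a \<in> B" "b \<in> B" and "v \<in> open_segment a b"
      then obtain u where u: "0 < u" "u < 1" "v = (1 - u) *\<^sub>R a + u *\<^sub>R b" and ne: "a \<noteq> b"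
        by (auto simp: in_segment)
      define D where "D = 1 + \<bar>coord_sum (a - v)\<bar> + \<bar>coord_sum (b - v)\<bar>"
      \<comment> \<open>Contracts a segment of \<open>B\<close> through \<open>v\<close> towards
        \<open>v\<close> until both ends lie below the cut; \<open>D\<close> bounds the growth of
        \<open>coord_sum\<close> towards either end.\<close>
      define \<epsilon> where "\<epsilon> = min 1 ((M - coord_sum v) / D)"
      have D: "D > 0"
        by (simp add: D_def)
      have \<epsilon>: "0 < \<epsilon>" "\<epsilon> \<le> 1" "\<epsilon> \<le> (M - coord_sum v) / D"
        using False vB D by (auto simp: \<epsilon>_def)
      then have \<epsilon>D: "\<epsilon> * D \<le> M - coord_sum v"
        using D by (simp add: pos_le_divide_eq)
      have trunc: "(1 - \<epsilon>) *\<^sub>R v + \<epsilon> *\<^sub>R w \<in> truncate M B" if w: "w \<in> {a, b}" for w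
      proof -
        have "(1 - \<epsilon>) *\<^sub>R v + \<epsilon> *\<^sub>R w \<in> B"
          using w ab vB \<epsilon> by (intro convexD sub) auto
        moreover have "coord_sum ((1 - \<epsilon>) *\<^sub>R v + \<epsilon> *\<^sub>R w) = coord_sum v + \<epsilon> * coord_sum (w - v)"
          by (simp add: algebra_simps)
        moreover have "\<epsilon> * coord_sum (w - v) \<le> \<epsilon> * D"
          using w \<epsilon> by (intro mult_left_mono) (auto simp: D_def simp del: coord_sum_simps(3))
        ultimately show ?thesis
          using \<epsilon>D by (auto simp only: truncate_def mem_Collect_eq)
      qed
      have "v = (1 - u) *\<^sub>R ((1 - \<epsilon>) *\<^sub>R v + \<epsilon> *\<^sub>R a) + u *\<^sub>R ((1 - \<epsilon>) *\<^sub>R v + \<epsilon> *\<^sub>R b)"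
      proof -
        have "(1 - u) *\<^sub>R ((1 - \<epsilon>) *\<^sub>R v + \<epsilon> *\<^sub>R a) + u *\<^sub>R ((1 - \<epsilon>) *\<^sub>R v + \<epsilon> *\<^sub>R b) =
            (1 - \<epsilon>) *\<^sub>R v + \<epsilon> *\<^sub>R ((1 - u) *\<^sub>R a + u *\<^sub>R b)"
          by (simp add: algebra_simps)
        also have "\<dots> = v"
          unfolding u(3)[symmetric] by (simp flip: scaleR_add_left)
        finally show ?thesis ..
      qed
      moreover have "(1 - \<epsilon>) *\<^sub>R v + \<epsilon> *\<^sub>R a \<noteq> (1 - \<epsilon>) *\<^sub>R v + \<epsilon> *\<^sub>R b"
        using ne \<epsilon> by simp
      ultimately have "v \<in> open_segment ((1 - \<epsilon>) *\<^sub>R v + \<epsilon> *\<^sub>R a) ((1 - \<epsilon>) *\<^sub>R v + \<epsilon> *\<^sub>R b)"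
        using u unfolding in_segment by blast
      then show False
        using v trunc by (auto simp: extreme_point_of_def)
    qed (rule vB)
    then show ?thesis
      using B by (simp add: lattice_polyhedron_def)
  qed
qed

lemma cofinal_from_insert:
  assumes "cofinal_from r X" "v \<in> positive_orthant"
  shows "cofinal_from r (convex hull (insert v X))"
proof -
  have "convex hull (insert v X) \<subseteq> positive_orthant"
    using assms by (intro hull_minimal convex_positive_orthant) (auto simp: cofinal_from_def)
  then show ?thesis
    using assms hull_subset[of "insert v X" convex] by (auto simp: cofinal_from_def)
qed

text \<open>Adding a point below the cut commutes with cutting. A segment from \<open>v\<close> to a
  point \<open>b\<close> above the cut may be shortened to where it crosses the cut, since the
  crossing point lies in \<open>X\<close>.\<close>

lemma truncate_insert:
  assumes X: "cofinal_from r X" and v: "v \<in> positive_orthant" "coord_sum v < r" and A: "convex hull A = truncate r X"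
  shows "truncate r (convex hull (insert v X)) = convex hull (insert v A)"
proof (intro antisym hull_minimal subsetI)
  have sub: "X \<subseteq> positive_orthant" "convex X" and large: "\<And>x. x \<in> positive_orthant \<Longrightarrow> r \<le> coord_sum x \<Longrightarrow> x \<in> X"
    using X by (auto simp: cofinal_from_def)
  have mono: "truncate r X \<subseteq> convex hull (insert v A)" and vin: "v \<in> convex hull (insert v A)"
    unfolding A[symmetric] by (auto intro: hull_mono[THEN subsetD] hull_inc)
  fix z assume "z \<in> truncate r (convex hull (insert v X))"
  then have z: "z \<in> convex hull (insert v X)" "coord_sum z \<le> r"
    by (auto simp: truncate_def)
  have "axis undefined (max 0 r) \<in> X"
    by (rule large) auto
  then have "X \<noteq> {}"
    by blast
  then obtain \<alpha> \<beta> b where zb: "z = \<alpha> *\<^sub>R v + \<beta> *\<^sub>R b" "0 \<le> \<alpha>" "0 \<le> \<beta>" "\<alpha> + \<beta> = 1" "b \<in> X"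
    using z(1) sub by (auto simp: convex_hull_insert convex_hull_eq[THEN iffD2])
  show "z \<in> convex hull (insert v A)"
  proof (cases "coord_sum b \<le> r")
    case True
    then show ?thesis
      using zb mono vin by (auto simp: truncate_def intro!: convexD[OF convex_convex_hull])
  next
    case False
    \<comment> \<open>The parameter at which the segment from \<open>v\<close> to \<open>b\<close>
      reaches level \<open>r\<close>; \<open>\<beta> \<le> \<theta>\<close> then says that
      \<open>z\<close> comes before the crossing.\<close>
    define \<theta> where "\<theta> = (r - coord_sum v) / (coord_sum b - coord_sum v)"
    have \<theta>: "0 < \<theta>" "\<theta> < 1" "\<theta> * (coord_sum b - coord_sum v) = r - coord_sum v"
      using v False by (auto simp: \<theta>_def field_simps)
    define b' where "b' = (1 - \<theta>) *\<^sub>R v + \<theta> *\<^sub>R b"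
    have "coord_sum b' = r"
      using \<theta>(3) by (simp add: b'_def algebra_simps)
    moreover have "b' \<in> positive_orthant"
      unfolding b'_def using \<theta> v zb sub by (intro convexD[OF convex_positive_orthant]) auto
    ultimately have b': "b' \<in> convex hull (insert v A)"
      using large mono by (auto simp: truncate_def)
    have "\<beta> * (coord_sum b - coord_sum v) \<le> \<theta> * (coord_sum b - coord_sum v)"
    proof -
      have \<alpha>: "\<alpha> = 1 - \<beta>"
        using zb by simp
      show ?thesis
        unfolding \<theta>(3) using z(2) by (simp add: zb(1) \<alpha> algebra_simps)
    qed
    then have le: "\<beta> \<le> \<theta>"
      using v False by (simp add: mult_le_cancel_right)
    have "z = (1 - \<beta> / \<theta>) *\<^sub>R v + (\<beta> / \<theta>) *\<^sub>R b'"
    proof -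
      have \<alpha>: "\<alpha> = 1 - \<beta>"
        using zb by simp
      show ?thesis
        using \<theta> by (simp add: b'_def zb(1) \<alpha> algebra_simps)
    qed
    then show ?thesis
      using b' vin le \<theta> zb by (auto intro!: convexD[OF convex_convex_hull])
  qed
next
  have "A \<subseteq> truncate r X"
    using A hull_subset by metis
  then show "x \<in> truncate r (convex hull (insert v X))" if "x \<in> insert v A" for x
    using that v by (auto simp: truncate_def hull_inc)
qed (simp add: convex_truncate)

lemma interior_truncate_nonempty:
  fixes X :: "(real^'n::finite) set"
  assumes X: "cofinal_from r X" "0 \<le> r" "r < M"
  shows "interior (truncate M X) \<noteq> {}"
proof -
  let ?U = "{x :: real^'n. \<forall>i. 0 < x $ i} \<inter> {x. r < coord_sum x} \<inter> {x. coord_sum x < M}"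
  have open_positive: "open {x :: real^'n. \<forall>i. 0 < x $ i}"
  proof -
    have "{x :: real^'n. \<forall>i. 0 < x $ i} = (\<Inter>i. {x. 0 < x $ i})"
      by auto
    then show ?thesis
      by (simp only:) (intro open_INT open_Collect_less continuous_intros ballI finite)
  qed
  have "open ?U"
    by (intro open_Int open_Collect_less open_positive continuous_intros)
  moreover have "?U \<subseteq> truncate M X"
    using X by (auto simp: cofinal_from_def truncate_def positive_orthant_def less_imp_le subset_iff)
  ultimately have "?U \<subseteq> interior (truncate M X)"
    by (intro interior_maximal)
  moreover have "(\<chi> i. (r + M) / 2 / CARD('n)) \<in> ?U"
    using X by (auto simp: coord_sum_def)
  ultimately show ?thesis by blast
qed

lemma coord_sum_less_bound:
  fixes S :: "(real^'n::finite) set"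
  assumes "bounded S"
  obtains r where "0 \<le> r" "\<And>x. x \<in> S \<Longrightarrow> coord_sum x < r"
proof -
  obtain K where K: "\<And>x. x \<in> S \<Longrightarrow> norm x \<le> K"
    using assms by (auto simp: bounded_iff)
  show thesis
  proof
    show "0 \<le> CARD('n) * \<bar>K\<bar> + 1"
      by simp
    fix x assume "x \<in> S"
    then have "x $ i \<le> \<bar>K\<bar>" for i
      using K[of x] component_le_norm_cart[of x i] by linarith
    then have "coord_sum x \<le> (\<Sum>i\<in>(UNIV :: 'n set). \<bar>K\<bar>)"
      unfolding coord_sum_def by (intro sum_mono)
    then show "coord_sum x < CARD('n) * \<bar>K\<bar> + 1"
      by simp
  qed
qed

text \<open>The first point of \<open>B\<close> on the axis is a vertex: the axis is a face of the
  orthant, so a segment of \<open>B\<close> through that point stays on the axis, where nothing of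
  \<open>B\<close> precedes it. Hence \<open>p\<close> is integral, and \<open>p - 1\<close> falls
  short of \<open>B\<close>.\<close>

lemma lattice_polyhedron_axis_vertex:
  fixes B :: "(real^'n::finite) set"
  assumes B: "cofinal_from r B" "lattice_polyhedron B" and not: "axis j s \<notin> B" and s: "0 \<le> s"
  obtains p where "s < p" "p \<in> \<int>" "axis j p \<in> B" "axis j (p - 1) \<notin> B"
proof -
  define T where "T = {t. 0 \<le> t \<and> axis j t \<in> B}"
  have sub: "B \<subseteq> positive_orthant"
    using B by (auto simp: cofinal_from_def)
  have "closed B"
    using B by (auto simp: lattice_polyhedron_def intro: polyhedron_imp_closed)
  moreover have "continuous_on UNIV (axis j :: real \<Rightarrow> real^'n)"
  proof -
    have eq: "(\<lambda>t::real. t *\<^sub>R axis j 1) = (axis j :: real \<Rightarrow> real^'n)"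
      by (simp add: axis_def vec_eq_iff fun_eq_iff)
    have "continuous_on UNIV (\<lambda>t::real. t *\<^sub>R (axis j 1 :: real^'n))"
      by (intro continuous_intros)
    then show ?thesis
      unfolding eq .
  qed
  ultimately have "closed (axis j -` B)"
    by (simp add: continuous_on_closed_vimage)
  then have "closed ({0..} \<inter> axis j -` B)"
    by (intro closed_Int closed_atLeast)
  moreover have "{0..} \<inter> axis j -` B = T"
    by (auto simp: T_def)
  moreover have "max 0 r \<in> T"
    by (auto simp: T_def intro!: cofinal_from_memI[OF B(1)])
  moreover have bdd: "bdd_below T"
    by (rule bdd_belowI[of _ 0]) (auto simp: T_def)
  ultimately have T: "Inf T \<in> T"
    by (intro closed_contains_Inf) auto
  define p where "p = Inf T"
  have p: "0 \<le> p" "axis j p \<in> B"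
    using T by (auto simp: T_def p_def)
  have min: "p \<le> t" if "axis j t \<in> B" for t
  proof -
    have "0 \<le> (axis j t :: real^'n) $ j"
      using that sub unfolding positive_orthant_def by blast
    then show ?thesis
      using that bdd by (auto simp: p_def T_def axis_def intro: cInf_lower)
  qed
  have "s < p"
  proof (rule ccontr)
    assume "\<not> s < p"
    then have "axis j p + axis j (s - p) \<in> B"
      by (intro cofinal_from_add[OF B(1) p(2)]) auto
    moreover have "axis j p + axis j (s - p) = (axis j s :: real^'n)"
      by (simp add: vec_eq_iff axis_def)
    ultimately show False
      using not by simp
  qed
  moreover have "axis j p extreme_point_of B"
    unfolding extreme_point_of_def
  proof (intro conjI ballI notI)
    fix a b assume ab: "a \<in> B" "b \<in> B" and "axis j p \<in> open_segment a b"
    then obtain u where u: "0 < u" "u < 1" "axis j p = (1 - u) *\<^sub>R a + u *\<^sub>R b" and ne: "a \<noteq> b"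
      by (auto simp: in_segment)
    have nonneg: "0 \<le> a $ k" "0 \<le> b $ k" for k
      using ab sub unfolding positive_orthant_def by auto
    have comp: "(if k = j then p else 0) = (1 - u) * a $ k + u * b $ k" for k
      using arg_cong[OF u(3), of "\<lambda>v. v $ k"] by (simp add: axis_def)
    have "a $ k = 0 \<and> b $ k = 0" if "k \<noteq> j" for k
    proof -
      have "0 \<le> (1 - u) * a $ k" "0 \<le> u * b $ k"
        using nonneg u by auto
      moreover have "(1 - u) * a $ k + u * b $ k = 0"
        using comp[of k] that by simp
      ultimately have "(1 - u) * a $ k = 0" "u * b $ k = 0"
        by linarith+
      then show ?thesis
        using u by simp
    qed
    then have axes: "a = axis j (a $ j)" "b = axis j (b $ j)"
      by (auto simp: vec_eq_iff axis_def)
    then have le: "p \<le> a $ j" "p \<le> b $ j"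
      using ab min by metis+
    have "(1 - u) * (a $ j - p) + u * (b $ j - p) = 0"
      using comp[of j] by (simp add: algebra_simps)
    moreover have "0 \<le> (1 - u) * (a $ j - p)" "0 \<le> u * (b $ j - p)"
      using le u by auto
    ultimately have "(1 - u) * (a $ j - p) = 0" "u * (b $ j - p) = 0"
      by linarith+
    then have "a $ j = b $ j"
      using u by simp
    then show False
      using axes ne by metis
  qed (rule p)
  then have "(axis j p :: real^'n) $ j \<in> \<int>"
    using B(2) unfolding lattice_polyhedron_def by blast
  then have "p \<in> \<int>"
    by (simp add: axis_def)
  moreover have "axis j (p - 1) \<notin> B"
    using min[of "p - 1"] by auto
  ultimately show thesis
    using that p by blast
qed

text \<open>Reduces the goal to the points \<open>axis j s\<close>: a point of the cone is scaled
  down to the simplex they span, and the remainder is regained by upward closure.\<close>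

lemma cone_above_subsetI:
  fixes B :: "(real^'n::finite) set"
  assumes B: "cofinal_from r B" and s: "0 < s" and axes: "\<And>j. axis j s \<in> B"
  shows "cone_above positive_orthant (\<lambda>_. s) \<subseteq> B"
proof
  fix x :: "real^'n" assume "x \<in> cone_above positive_orthant (\<lambda>_. s)"
  then have x: "x \<in> positive_orthant" "s \<le> coord_sum x"
    using s by (auto simp: cone_above_def coord_sum_def simp flip: sum_divide_distrib)
  define \<theta> where "\<theta> = s / coord_sum x"
  have \<theta>: "0 \<le> \<theta>" "\<theta> \<le> 1" "\<theta> * coord_sum x = s"
    using x s by (auto simp: \<theta>_def)
  have "\<theta> *\<^sub>R x \<in> convex hull (range (\<lambda>i. axis i s))"
    using x s \<theta> by (intro facet_in_hull) auto
  moreover have "convex hull (range (\<lambda>i. axis i s)) \<subseteq> B"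
    using axes B by (intro hull_minimal) (auto simp: cofinal_from_def)
  ultimately have "\<theta> *\<^sub>R x + (1 - \<theta>) *\<^sub>R x \<in> B"
    using x \<theta> by (intro cofinal_from_add[OF B]) auto
  then show "x \<in> B"
    by (simp flip: scaleR_add_left)
qed

section \<open>The contradiction arising from a missing point on a coordinate axis\<close>

theorem theorem6:
  fixes B :: "'n::finite \<Rightarrow> (real ^ 'n) set" and V :: nat
  assumes "V > 0"
    and "\<And>i. lattice_polyhedron (B i)"
    and "\<And>i. B i \<subseteq> positive_orthant"
    and "\<And>i. bounded (positive_orthant - B i)"
    and "minimal_with_mixed_volume positive_orthant B (real V)"
  shows "\<forall>i. cone_above positive_orthant (\<lambda>_. real V) \<subseteq> B i"
proof (rule ccontr)
  assume "\<not> ?thesis"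
  then obtain m where m: "\<not> cone_above positive_orthant (\<lambda>_. real V) \<subseteq> B m"
    by blast
  have "bounded (\<Union>i. positive_orthant - B i)"
    by (intro bounded_UN) (use assms(4) in auto)
  then obtain r where r: "0 \<le> r" "\<And>x. x \<in> (\<Union>i. positive_orthant - B i) \<Longrightarrow> coord_sum x < r"
    using coord_sum_less_bound by blast
  have cof: "cofinal_from r (B i)" for i
    unfolding cofinal_from_def using assms(2,3)[of i] r(2)
    by (auto simp: lattice_polyhedron_def polyhedron_imp_convex) (meson UN_iff DiffI UNIV_I not_le)
  obtain j where "axis j (real V) \<notin> B m"
    using cone_above_subsetI[OF cof] m assms(1) by (metis of_nat_0_less_iff)
  then obtain p where p: "real V < p" "p \<in> \<int>" "axis j p \<in> B m" "axis j (p - 1) \<notin> B m"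
    using lattice_polyhedron_axis_vertex[OF cof assms(2)] by (metis of_nat_0_le_iff)
  \<comment> \<open>The lattice point next to the vertex: integral, so that the jump is at least 1,
    yet so close that the scaling ratio \<open>(p - 1) / p\<close> loses only
    \<open>1 / p\<close>.\<close>
  define \<delta> :: "real^'n" where "\<delta> = axis j (p - 1)"
  have p1: "1 < p"
    using p(1) assms(1) by (simp add: Suc_le_eq[symmetric])
  \<comment> \<open>Above \<open>r\<close>, the cut meets every \<open>B i\<close> in a full simplex
    and leaves it full-dimensional; above \<open>p\<close>, both \<open>axis j p\<close> and
    \<open>\<delta>\<close> survive it. Being natural, \<open>M\<close> keeps the new vertices
    integral.\<close>
  obtain M :: nat where M: "max r p < real M"
    using reals_Archimedean2 by blast
  have M0: "0 < M"
    using M p1 by (cases M) auto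
  define A where "A i = {x. x extreme_point_of truncate M (B i)}" for i
  have A: "finite (A i)" "convex hull A i = truncate M (B i)" "v \<in> A i \<Longrightarrow> v $ k \<in> \<int>" for i v k
    unfolding A_def using extreme_points_truncate[OF cof[of i] assms(2)[of i], of M] M M0 by auto
  define A' where "A' i = (if i = m then insert \<delta> (A i) else A i)" for i
  let ?\<Delta> = "insert 0 (range (\<lambda>i. axis i (real M))) :: (real^'n) set"
  have \<Delta>: "convex hull ?\<Delta> = truncate M positive_orthant"
    using M0 by (intro hull_simplex) simp
  have \<delta>: "\<delta> \<in> positive_orthant" "coord_sum \<delta> < M" "\<delta> \<notin> B m"
    using p p1 M by (auto simp: \<delta>_def)
  have cof_M: "cofinal_from M (B i)" for i
    using cofinal_from_mono[OF cof, of M] M by simp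
  have "rel_mixed_volume positive_orthant B =
      mixed_volume (\<lambda>_::'n. convex hull ?\<Delta>) - mixed_volume (\<lambda>i. convex hull A i)"
    unfolding A \<Delta> using cof_M M0 by (intro rel_mixed_volume_eq_mixed_volume_diff) auto
  then have V: "mixed_volume (\<lambda>_::'n. convex hull ?\<Delta>) - mixed_volume (\<lambda>i. convex hull A i) = V"
    using assms(5) by (simp add: minimal_with_mixed_volume_def)
  let ?B' = "B(m := convex hull (insert \<delta> (B m)))"
  have "rel_mixed_volume positive_orthant ?B' =
      mixed_volume (\<lambda>_::'n. truncate M positive_orthant) - mixed_volume (\<lambda>i. truncate M (?B' i))"
    using cof_M cofinal_from_insert[OF cof_M \<delta>(1)] M0 by (intro rel_mixed_volume_eq_mixed_volume_diff) auto
  moreover have "(\<lambda>i. truncate M (?B' i)) = (\<lambda>i. convex hull A' i)"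
    using truncate_insert[OF cof_M \<delta>(1,2) A(2)] A(2) by (auto simp: A'_def fun_eq_iff)
  moreover have "rel_mixed_volume positive_orthant ?B' < V"
    using assms(5) \<delta> by (auto simp: minimal_with_mixed_volume_def)
  ultimately have less: "mixed_volume (\<lambda>i. convex hull A i) < mixed_volume (\<lambda>i. convex hull A' i)"
    using V \<Delta> by simp
  \<comment> \<open>The weights \<open>(p - 1) / p\<close> and \<open>1 / p\<close> come from
    writing \<open>\<delta>\<close> as a combination of the vertex \<open>axis j p\<close> and the
    origin, which belongs to the simplex. The bracket is \<open>V\<close>, so the claim reads
    \<open>p \<le> V\<close>, against \<open>V < p\<close>.\<close>
  have "1 \<le> (1 / p) * (mixed_volume (\<lambda>_::'n. convex hull ?\<Delta>) - mixed_volume (\<lambda>i. convex hull A i))"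
  proof (rule mixed_volume_gap[where B = A' and m = m and s = "(p - 1) / p"])
    show "v $ k \<in> \<int>" if "v \<in> A' i" for i v k
      using that A(3) p(2) by (auto simp: A'_def \<delta>_def axis_def split: if_splits)
    show "interior (convex hull A i) \<noteq> {}" for i
      unfolding A using interior_truncate_nonempty[OF cof r(1)] M by auto
    have AP: "A i \<subseteq> convex hull A i" for i
      by (rule hull_subset)
    have "convex hull A i \<subseteq> convex hull ?\<Delta>" for i
      using assms(3)[of i] unfolding A(2) \<Delta> by (auto simp: truncate_def)
    note AP = AP this
    then show "A i \<subseteq> convex hull ?\<Delta>" for i
      by blast
    show "A' m \<subseteq> (*\<^sub>R) ((p - 1) / p) ` (convex hull A m) + (*\<^sub>R) (1 / p) ` (convex hull ?\<Delta>)"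
    proof
      fix v assume "v \<in> A' m"
      then consider "v = \<delta>" | "v \<in> A m"
        by (auto simp: A'_def)
      then obtain x y where "x \<in> convex hull A m" "y \<in> convex hull ?\<Delta>" "v = ((p - 1) / p) *\<^sub>R x + (1 / p) *\<^sub>R y"
      proof cases
        case 1
        show ?thesis
        proof (rule that)
          show "axis j p \<in> convex hull A m"
            unfolding A using p M by (simp add: truncate_def)
          show "0 \<in> convex hull ?\<Delta>"
            by (simp add: hull_inc)
          show "v = ((p - 1) / p) *\<^sub>R axis j p + (1 / p) *\<^sub>R 0"
            using 1 p1 by (simp add: \<delta>_def axis_def vec_eq_iff)
        qed
      next
        case 2
        have "((p - 1) / p) *\<^sub>R v + (1 / p) *\<^sub>R v = v"
          using p1 by (simp add: field_simps flip: scaleR_add_left)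
        then show ?thesis
          using 2 AP[of m] by (intro that[of v v]) auto
      qed
      then show "v \<in> (*\<^sub>R) ((p - 1) / p) ` (convex hull A m) + (*\<^sub>R) (1 / p) ` (convex hull ?\<Delta>)"
        by (auto intro: set_plus_intro)
    qed
  qed (use A p1 less in \<open>auto simp: A'_def field_simps\<close>)
  then show False
    unfolding V using p(1) p1 by (simp add: field_simps)
qed

end
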